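(* Let $V$ be a nonzero finite-dimensional vector space over $\mathbb K$ and let $A,A^*$ be a tridiagonal pair on $V$. Let $\theta_0,\dots,\theta_d$ (resp. $\theta^*_0,\dots,\theta^*_d$) be a standard ordering of the eigenvalues of $A$ (resp. $A^*$). Assume there exist nonzero scalars $a,a^*\in\mathbb K$ such that $\theta_i=aq^{2i-d}$ and $\theta^*_i=a^*q^{d-2i}$ for $0\le i\le d$. Then there exists a unique $\mathcal U$-module structure on $V$ such that $ay^-_1$ acts as $A$ and $a^*y^-_0$ acts as $A^*$. Moreover there exists a unique $\mathcal U$-module structure on $V$ such that $ay^+_0$ acts as $A$ and $a^*y^+_1$ acts as $A^*$. Both $\mathcal U$-module structures are irreducible.
   Context: $\mathbb K$ is an algebraically closed field and $q\in\mathbb K$ is nonzero and not a root of unity; $[3]_q=\frac{q^3-q^{-3}}{q-q^{-1}}$. $\mathcal U$ denotes the unital associative $\mathbb K$-algebra (isomorphic to the quantum affine algebra $U_q(\widehat{sl}_2)$) with generators $y^{\pm}_i,k_i^{\pm1}$ ($i\in\{0,1\}$) and relations: $k_ik_i^{-1}=k_i^{-1}k_i=1$; $k_0k_1$ is central; $\frac{qy^+_ik_i-q^{-1}k_iy^+_i}{q-q^{-1}}=1$; $\frac{qk_iy^-_i-q^{-1}y^-_ik_i}{q-q^{-1}}=1$; $\frac{qy^-_iy^+_i-q^{-1}y^+_iy^-_i}{q-q^{-1}}=1$; $\frac{qy^+_iy^-_j-q^{-1}y^-_jy^+_i}{q-q^{-1}}=k_0^{-1}k_1^{-1}$ for $i\neq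 j$; $(y^{\pm}_i)^3y^{\pm}_j-[3]_q(y^{\pm}_i)^2y^{\pm}_jy^{\pm}_i+[3]_qy^{\pm}_iy^{\pm}_j(y^{\pm}_i)^2-y^{\pm}_j(y^{\pm}_i)^3=0$ for $i\neq j$. A tridiagonal pair on $V$ is an ordered pair $A,A^*$ of linear maps $V\to V$ such that: (i) each of $A,A^*$ is diagonalizable; (ii) there is an ordering $V_0,\dots,V_d$ of the eigenspaces of $A$ with $A^*V_i\subseteq V_{i-1}+V_i+V_{i+1}$ for $0\le i\le d$ (where $V_{-1}=V_{d+1}=0$); (iii) there is an ordering $V^*_0,\dots,V^*_\delta$ of the eigenspaces of $A^*$ with $AV^*_i\subseteq V^*_{i-1}+V^*_i+V^*_{i+1}$ for $0\le i\le\delta$ (where $V^*_{-1}=V^*_{\delta+1}=0$); (iv) there is no subspace $W$ with $AW\subseteq W$, $A^*W\subseteq W$, $W\ne0$, $W\neq V$. It is known that $d=\delta$. An ordering of the eigenspaces of $A$ (resp. $A^*$) satisfying (ii) (resp. (iii)) is called standard; an ordering of the eigenvalues is standard if the corresponding ordering of eigenspaces is standard. *)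

theory Defs
  imports "HOL-Computational_Algebra.Polynomial"
begin

definition alg_closed :: "'K::field itself \<Rightarrow> bool" where
  "alg_closed _ \<longleftrightarrow> (\<forall>p :: 'K poly. degree p > 0 \<longrightarrow> (\<exists>x. poly p x = 0))"

definition qint3 :: "'K::field \<Rightarrow> 'K" where
  "qint3 q = (q ^ 3 - inverse q ^ 3) / (q - inverse q)"

definition eigenspace :: "('K::field \<Rightarrow> 'v::ab_group_add \<Rightarrow> 'v) \<Rightarrow> ('v \<Rightarrow> 'v) \<Rightarrow> 'K \<Rightarrow> 'v set" where
  "eigenspace sc f lam = {v. f v = sc lam v}"

definition is_eigenvalue :: "('K::field \<Rightarrow> 'v::ab_group_add \<Rightarrow> 'v) \<Rightarrow> ('v \<Rightarrow> 'v) \<Rightarrow> 'K \<Rightarrow> bool" where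
  "is_eigenvalue sc f lam \<longleftrightarrow> (\<exists>v. v \<noteq> 0 \<and> f v = sc lam v)"

definition diagonalizable :: "('K::field \<Rightarrow> 'v::ab_group_add \<Rightarrow> 'v) \<Rightarrow> ('v \<Rightarrow> 'v) \<Rightarrow> bool" where
  "diagonalizable sc f \<longleftrightarrow>
     module.span sc (\<Union>lam\<in>{lam. is_eigenvalue sc f lam}. eigenspace sc f lam) = UNIV"

definition eigenvalue_ordering ::
  "('K::field \<Rightarrow> 'v::ab_group_add \<Rightarrow> 'v) \<Rightarrow> ('v \<Rightarrow> 'v) \<Rightarrow> nat \<Rightarrow> (nat \<Rightarrow> 'K) \<Rightarrow> bool" where
  "eigenvalue_ordering sc f d \<theta> \<longleftrightarrow>
     inj_on \<theta> {..d} \<and> \<theta> ` {..d} = {lam. is_eigenvalue sc f lam}"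

definition ord_eigenspace ::
  "('K::field \<Rightarrow> 'v::ab_group_add \<Rightarrow> 'v) \<Rightarrow> ('v \<Rightarrow> 'v) \<Rightarrow> nat \<Rightarrow> (nat \<Rightarrow> 'K) \<Rightarrow> int \<Rightarrow> 'v set" where
  "ord_eigenspace sc f d \<theta> i =
     (if 0 \<le> i \<and> i \<le> int d then eigenspace sc f (\<theta> (nat i)) else {0})"

definition standard_ordering ::
  "('K::field \<Rightarrow> 'v::ab_group_add \<Rightarrow> 'v) \<Rightarrow> ('v \<Rightarrow> 'v) \<Rightarrow> ('v \<Rightarrow> 'v) \<Rightarrow> nat \<Rightarrow> (nat \<Rightarrow> 'K) \<Rightarrow> bool" where
  "standard_ordering sc f g d \<theta> \<longleftrightarrow>
     eigenvalue_ordering sc f d \<theta> \<and>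
     (\<forall>i::int. 0 \<le> i \<and> i \<le> int d \<longrightarrow>
        g ` ord_eigenspace sc f d \<theta> i \<subseteq>
        module.span sc (ord_eigenspace sc f d \<theta> (i - 1) \<union> ord_eigenspace sc f d \<theta> i
                        \<union> ord_eigenspace sc f d \<theta> (i + 1)))"

definition tridiagonal_pair ::
  "('K::field \<Rightarrow> 'v::ab_group_add \<Rightarrow> 'v) \<Rightarrow> ('v \<Rightarrow> 'v) \<Rightarrow> ('v \<Rightarrow> 'v) \<Rightarrow> bool" where
  "tridiagonal_pair sc A As \<longleftrightarrow>
     Vector_Spaces.linear sc sc A \<and> Vector_Spaces.linear sc sc As \<and>
     diagonalizable sc A \<and> diagonalizable sc As \<and>
     (\<exists>d \<theta>. standard_ordering sc A As d \<theta>) \<and>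
     (\<exists>\<delta> \<theta>s. standard_ordering sc As A \<delta> \<theta>s) \<and>
     (\<forall>W. module.subspace sc W \<and> A ` W \<subseteq> W \<and> As ` W \<subseteq> W \<longrightarrow> W = {0} \<or> W = UNIV)"

datatype idx = I0 | I1
datatype ugen = Yp idx | Ym idx | Kg idx | Kinv idx

(* A U-module structure on V: an action of each generator by a linear map such that
   the defining relations of U hold. *)
definition is_U_module ::
  "('K::field \<Rightarrow> 'v::ab_group_add \<Rightarrow> 'v) \<Rightarrow> 'K \<Rightarrow> (ugen \<Rightarrow> 'v \<Rightarrow> 'v) \<Rightarrow> bool" where
  "is_U_module sc q \<rho> \<longleftrightarrow>
     (\<forall>g. Vector_Spaces.linear sc sc (\<rho> g)) \<and>
     (let c = inverse (q - inverse q);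
          lc = (\<lambda>f h v. sc c (sc q (f (h v)) - sc (inverse q) (h (f v)))) in
     (\<forall>i. \<rho> (Kg i) \<circ> \<rho> (Kinv i) = id \<and> \<rho> (Kinv i) \<circ> \<rho> (Kg i) = id) \<and>
     (\<forall>g. (\<rho> (Kg I0) \<circ> \<rho> (Kg I1)) \<circ> \<rho> g = \<rho> g \<circ> (\<rho> (Kg I0) \<circ> \<rho> (Kg I1))) \<and>
     (\<forall>i. lc (\<rho> (Yp i)) (\<rho> (Kg i)) = id) \<and>
     (\<forall>i. lc (\<rho> (Kg i)) (\<rho> (Ym i)) = id) \<and>
     (\<forall>i. lc (\<rho> (Ym i)) (\<rho> (Yp i)) = id) \<and>
     (\<forall>i j. i \<noteq> j \<longrightarrow> lc (\<rho> (Yp i)) (\<rho> (Ym j)) = \<rho> (Kinv I0) \<circ> \<rho> (Kinv I1)) \<and>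
     (\<forall>i j. i \<noteq> j \<longrightarrow> (\<forall>Y \<in> {Yp, Ym}. \<forall>v.
        let x = \<rho> (Y i); y = \<rho> (Y j) in
        x (x (x (y v))) - sc (qint3 q) (x (x (y (x v)))) + sc (qint3 q) (x (y (x (x v))))
          - y (x (x (x v))) = 0)))"

definition irreducible_U_module ::
  "('K::field \<Rightarrow> 'v::ab_group_add \<Rightarrow> 'v) \<Rightarrow> 'K \<Rightarrow> (ugen \<Rightarrow> 'v \<Rightarrow> 'v) \<Rightarrow> bool" where
  "irreducible_U_module sc q \<rho> \<longleftrightarrow> is_U_module sc q \<rho> \<and> (\<exists>v::'v. v \<noteq> 0) \<and>
     (\<forall>W. module.subspace sc W \<and> (\<forall>g. \<rho> g ` W \<subseteq> W) \<longrightarrow> W = {0} \<or> W = UNIV)"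

end

theory Submission
  imports Defs
begin

text \<open>
  Put \<open>X = A / a\<close>, \<open>Y = A\<^sup>* / a\<^sup>*\<close>, and write \<open>f \<rightarrow> g\<close> for \<open>q f g - q\<^sup>-\<^sup>1 g f = q - q\<^sup>-\<^sup>1\<close>. The first module
  structure amounts to maps \<open>P = y\<^sub>1\<^sup>+\<close>, \<open>Q = y\<^sub>0\<^sup>+\<close>, \<open>K = k\<^sub>1 = k\<^sub>0\<^sup>-\<^sup>1\<close> with
  \<open>X \<rightarrow> P \<rightarrow> Y \<rightarrow> Q \<rightarrow> X\<close>, \<open>P \<rightarrow> K \<rightarrow> X\<close> and \<open>Q \<rightarrow> K\<^sup>-\<^sup>1 \<rightarrow> Y\<close>, together with the Serre relations.

  Given standard orderings of the eigenspaces \<open>V\<^sub>i\<close> of \<open>X\<close> and \<open>V\<^sup>*\<^sub>i\<close> of \<open>Y\<close>, let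
  \<open>F\<^sub>i = \<Sum>\<^sub>k\<^sub>\<ge>\<^sub>i V\<^sub>k\<close>, \<open>G\<^sub>i = \<Sum>\<^sub>k\<^sub>\<le>\<^sub>i V\<^sup>*\<^sub>k\<close> and \<open>U\<^sub>i = G\<^sub>i \<inter> F\<^sub>i\<close>. Irreducibility makes \<open>V\<close> the direct
  sum of the \<open>U\<^sub>i\<close>, and \<open>X - \<theta>\<^sub>i\<close> and \<open>Y - \<theta>\<^sup>*\<^sub>i\<close> map \<open>U\<^sub>i\<close> into \<open>U\<^sub>i\<^sub>+\<^sub>1\<close> and \<open>U\<^sub>i\<^sub>-\<^sub>1\<close>. The maps \<open>K\<close>, \<open>P\<close>,
  \<open>Q\<close> act as scalars on the summands of three such decompositions, obtained from the given
  orderings, by reversing that of \<open>X\<close>, and by reversing that of \<open>Y\<close>. Conversely, a relation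
  \<open>f \<rightarrow> g\<close> makes \<open>g\<close> minus a scalar shift each eigenspace of \<open>f\<close> to a neighbouring one (and vice
  versa), so the relations force these scalars, whence uniqueness. The second module structure is
  the first one for \<open>q\<^sup>-\<^sup>1\<close>, up to relabelling the generators.
\<close>

section \<open>Split decompositions\<close>

locale endomorphisms = vector_space scale
  for scale :: "'K::field \<Rightarrow> 'v::ab_group_add \<Rightarrow> 'v" (infixr "*s" 75)
begin

abbreviation "endo f \<equiv> Vector_Spaces.linear scale scale f"

lemma endoI:
  assumes "\<And>x y. f (x + y) = f x + f y" and "\<And>c x. f (c *s x) = c *s f x"
  shows "endo f"
  by unfold_locales (use assms in auto)

lemma endo_add: "endo f \<Longrightarrow> f (x + y) = f x + f y"
  by (rule module_hom.add[OF Vector_Spaces.linear.axioms(3)])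

lemma endo_scale: "endo f \<Longrightarrow> f (c *s x) = c *s f x"
  by (rule module_hom.scale[OF Vector_Spaces.linear.axioms(3)])

lemma endo_zero: "endo f \<Longrightarrow> f 0 = 0"
  by (rule module_hom.zero[OF Vector_Spaces.linear.axioms(3)])

lemma endo_diff: "endo f \<Longrightarrow> f (x - y) = f x - f y"
  by (rule module_hom.diff[OF Vector_Spaces.linear.axioms(3)])

lemmas endo_simps = endo_add endo_scale endo_zero endo_diff

lemma endo_maps_span:
  assumes "endo f" "subspace T" "\<And>s. s \<in> S \<Longrightarrow> f s \<in> T" "v \<in> span S"
  shows "f v \<in> T"
  using assms(4)
proof (induction rule: span_induct_alt)
  case base
  then show ?case using assms by (simp add: endo_zero subspace_0)
next
  case (step c x y)
  then show ?case using assms by (simp add: endo_simps subspace_add subspace_scale)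
qed

lemma endo_eq_on_span:
  assumes "endo f" "endo g" "span S = UNIV" "\<And>s. s \<in> S \<Longrightarrow> f s = g s"
  shows "f = g"
proof
  fix v
  have "(\<lambda>v. f v - g v) v \<in> {0}"
  proof (rule endo_maps_span[where f = "\<lambda>v. f v - g v"])
    show "endo (\<lambda>v. f v - g v)"
      by (rule endoI) (use assms in \<open>simp_all add: endo_simps algebra_simps\<close>)
    show "v \<in> span S" using assms by simp
  qed (use assms in \<open>simp_all add: subspace_single_0\<close>)
  then show "f v = g v" by simp
qed

lemma endo_minus_scale: "endo f \<Longrightarrow> endo (\<lambda>v. f v - c *s v)"
  by (rule endoI) (simp_all add: endo_simps algebra_simps)

lemma in_span_mono: "A \<subseteq> B \<Longrightarrow> v \<in> span A \<Longrightarrow> v \<in> span B"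
  using span_mono by blast

end

text \<open>Both eigenvalue families run over all integers, with zero eigenspaces outside
  \<open>0..d\<close>, so that the neighbours \<open>i - 1\<close> and \<open>i + 1\<close> never
  need a boundary case.\<close>

locale split_pair = endomorphisms scale
  for scale :: "'K::field \<Rightarrow> 'v::ab_group_add \<Rightarrow> 'v" (infixr "*s" 75) +
  fixes X Y :: "'v \<Rightarrow> 'v" and \<theta> \<theta>s :: "int \<Rightarrow> 'K" and d :: int
  assumes d_nonneg: "0 \<le> d"
    and endo_X: "Vector_Spaces.linear scale scale X" and endo_Y: "Vector_Spaces.linear scale scale Y"
    and inj_\<theta>: "inj \<theta>" and inj_\<theta>s: "inj \<theta>s"
    and E_outside: "\<not> (0 \<le> i \<and> i \<le> d) \<Longrightarrow> eigenspace scale X (\<theta> i) = {0}"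
    and Es_outside: "\<not> (0 \<le> i \<and> i \<le> d) \<Longrightarrow> eigenspace scale Y (\<theta>s i) = {0}"
    and E_nonzero: "0 \<le> i \<Longrightarrow> i \<le> d \<Longrightarrow> \<exists>v. v \<noteq> 0 \<and> v \<in> eigenspace scale X (\<theta> i)"
    and Es_nonzero: "0 \<le> i \<Longrightarrow> i \<le> d \<Longrightarrow> \<exists>v. v \<noteq> 0 \<and> v \<in> eigenspace scale Y (\<theta>s i)"
    and E_span: "span (\<Union>i. eigenspace scale X (\<theta> i)) = UNIV"
    and Es_span: "span (\<Union>i. eigenspace scale Y (\<theta>s i)) = UNIV"
    and E_tri: "v \<in> eigenspace scale X (\<theta> i) \<Longrightarrow>
       Y v \<in> span (\<Union>k\<in>{i - 1..i + 1}. eigenspace scale X (\<theta> k))"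
    and Es_tri: "v \<in> eigenspace scale Y (\<theta>s i) \<Longrightarrow>
       X v \<in> span (\<Union>k\<in>{i - 1..i + 1}. eigenspace scale Y (\<theta>s k))"
    and irred: "subspace W \<Longrightarrow> (\<And>v. v \<in> W \<Longrightarrow> X v \<in> W) \<Longrightarrow> (\<And>v. v \<in> W \<Longrightarrow> Y v \<in> W)
       \<Longrightarrow> W = {0} \<or> W = UNIV"
begin

section \<open>The two flags and maps that shift them\<close>

definition F :: "int \<Rightarrow> 'v set" where
  "F j = span (\<Union>k\<in>{j..}. eigenspace scale X (\<theta> k))"

definition G :: "int \<Rightarrow> 'v set" where
  "G j = span (\<Union>k\<in>{..j}. eigenspace scale Y (\<theta>s k))"

definition U :: "int \<Rightarrow> 'v set" where
  "U i = G i \<inter> F i"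

lemma subspace_F: "subspace (F j)" and subspace_G: "subspace (G j)"
  by (simp_all add: F_def G_def)

lemma subspace_U: "subspace (U i)"
  by (simp add: U_def subspace_F subspace_G subspace_inter)

lemma F_antimono: "i \<le> j \<Longrightarrow> F j \<subseteq> F i"
  unfolding F_def by (intro span_mono UN_mono) auto

lemma G_mono: "i \<le> j \<Longrightarrow> G i \<subseteq> G j"
  unfolding G_def by (intro span_mono UN_mono) auto

lemma E_in_F: "v \<in> eigenspace scale X (\<theta> k) \<Longrightarrow> j \<le> k \<Longrightarrow> v \<in> F j"
  unfolding F_def by (intro span_base) auto

lemma Es_in_G: "v \<in> eigenspace scale Y (\<theta>s k) \<Longrightarrow> k \<le> j \<Longrightarrow> v \<in> G j"
  unfolding G_def by (intro span_base) auto

lemma endo_maps_F: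
  assumes "endo f" "subspace T" "\<And>k v. j \<le> k \<Longrightarrow> v \<in> eigenspace scale X (\<theta> k) \<Longrightarrow> f v \<in> T" "v \<in> F j"
  shows "f v \<in> T"
  by (rule endo_maps_span[OF assms(1,2) _ assms(4)[unfolded F_def]]) (use assms(3) in auto)

lemma endo_maps_G:
  assumes "endo f" "subspace T" "\<And>k v. k \<le> j \<Longrightarrow> v \<in> eigenspace scale Y (\<theta>s k) \<Longrightarrow> f v \<in> T" "v \<in> G j"
  shows "f v \<in> T"
  by (rule endo_maps_span[OF assms(1,2) _ assms(4)[unfolded G_def]]) (use assms(3) in auto)

lemma F_eq_0: "d < j \<Longrightarrow> F j = {0}"
proof -
  assume "d < j"
  then have "(\<Union>k\<in>{j..}. eigenspace scale X (\<theta> k)) = {0}"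
    using E_outside by auto
  then show ?thesis by (simp add: F_def)
qed

lemma G_eq_0: "j < 0 \<Longrightarrow> G j = {0}"
proof -
  assume "j < 0"
  then have "(\<Union>k\<in>{..j}. eigenspace scale Y (\<theta>s k)) = {0}"
    using Es_outside by auto
  then show ?thesis by (simp add: G_def)
qed

lemma F_eq_UNIV: assumes "j \<le> 0" shows "F j = UNIV"
proof -
  have "v \<in> F j" if "v \<in> eigenspace scale X (\<theta> k)" for v k
    using that E_outside[of k] E_in_F[of v k j] subspace_0[OF subspace_F] assms
    by (cases "0 \<le> k \<and> k \<le> d") auto
  then have "span (\<Union>i. eigenspace scale X (\<theta> i)) \<subseteq> F j"
    by (intro span_minimal subspace_F) auto
  then show ?thesis using E_span by auto
qed

lemma G_eq_UNIV: assumes "d \<le> j" shows "G j = UNIV"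
proof -
  have "v \<in> G j" if "v \<in> eigenspace scale Y (\<theta>s k)" for v k
    using that Es_outside[of k] Es_in_G[of v k j] subspace_0[OF subspace_G] assms
    by (cases "0 \<le> k \<and> k \<le> d") auto
  then have "span (\<Union>i. eigenspace scale Y (\<theta>s i)) \<subseteq> G j"
    by (intro span_minimal subspace_G) auto
  then show ?thesis using Es_span by auto
qed

text \<open>Eigenvectors with \<open>k > j\<close> already lie in \<open>F (j + 1)\<close>, so only
  the layer \<open>k = j\<close> decides the scalar. The \<open>\<mu> k\<close> need not be
  eigenvalues of \<open>X\<close>: besides \<open>X\<close> itself, this serves the unknown maps
  related to \<open>X\<close> by arrows.\<close>

lemma F_shift:
  assumes "endo M" and M: "\<And>k v. v \<in> eigenspace scale X (\<theta> k) \<Longrightarrow> M v - \<mu> k *s v \<in> F (k + 1)"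
    and "v \<in> F j"
  shows "M v - \<mu> j *s v \<in> F (j + 1)"
proof (rule endo_maps_F[OF _ subspace_F _ assms(3)])
  show "endo (\<lambda>v. M v - \<mu> j *s v)" by (rule endo_minus_scale) fact
  fix k v assume k: "j \<le> k" and v: "v \<in> eigenspace scale X (\<theta> k)"
  show "M v - \<mu> j *s v \<in> F (j + 1)"
  proof (cases "k = j")
    case True
    then show ?thesis using M[OF v] by simp
  next
    case False
    then have "v \<in> F (j + 1)" "F (k + 1) \<subseteq> F (j + 1)"
      using k v E_in_F F_antimono by auto
    moreover have "M v - \<mu> j *s v = (M v - \<mu> k *s v) + (\<mu> k - \<mu> j) *s v"
      by (simp add: algebra_simps)
    ultimately show ?thesis using M[OF v] subspace_F[of "j + 1"]
      by (metis subspace_add subspace_scale subsetD)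
  qed
qed

lemma G_shift:
  assumes "endo M" and M: "\<And>k v. v \<in> eigenspace scale Y (\<theta>s k) \<Longrightarrow> M v - \<mu> k *s v \<in> G (k - 1)"
    and "v \<in> G j"
  shows "M v - \<mu> j *s v \<in> G (j - 1)"
proof (rule endo_maps_G[OF _ subspace_G _ assms(3)])
  show "endo (\<lambda>v. M v - \<mu> j *s v)" by (rule endo_minus_scale) fact
  fix k v assume k: "k \<le> j" and v: "v \<in> eigenspace scale Y (\<theta>s k)"
  show "M v - \<mu> j *s v \<in> G (j - 1)"
  proof (cases "k = j")
    case True
    then show ?thesis using M[OF v] by simp
  next
    case False
    then have "v \<in> G (j - 1)" "G (k - 1) \<subseteq> G (j - 1)"
      using k v Es_in_G G_mono by auto
    moreover have "M v - \<mu> j *s v = (M v - \<mu> k *s v) + (\<mu> k - \<mu> j) *s v"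
      by (simp add: algebra_simps)
    ultimately show ?thesis using M[OF v] subspace_G[of "j - 1"]
      by (metis subspace_add subspace_scale subsetD)
  qed
qed

text \<open>Here the scalar does not matter, since \<open>v\<close> itself lies in the wider member
  of the flag. Keeping \<open>\<mu>\<close> lets the eigenspace estimates for arrows be plugged in
  unchanged.\<close>

lemma F_widen:
  assumes "endo M" and M: "\<And>k v. v \<in> eigenspace scale X (\<theta> k) \<Longrightarrow> M v - \<mu> k *s v \<in> F (k - 1)"
    and "v \<in> F j"
  shows "M v \<in> F (j - 1)"
proof (rule endo_maps_F[OF assms(1) subspace_F _ assms(3)])
  fix k v assume k: "j \<le> k" and v: "v \<in> eigenspace scale X (\<theta> k)"
  have "v \<in> F (j - 1)" "F (k - 1) \<subseteq> F (j - 1)"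
    using k v E_in_F F_antimono by auto
  moreover have "M v = (M v - \<mu> k *s v) + \<mu> k *s v" by simp
  ultimately show "M v \<in> F (j - 1)" using M[OF v] subspace_F[of "j - 1"]
    by (metis subspace_add subspace_scale subsetD)
qed

lemma G_widen:
  assumes "endo M" and M: "\<And>k v. v \<in> eigenspace scale Y (\<theta>s k) \<Longrightarrow> M v - \<mu> k *s v \<in> G (k + 1)"
    and "v \<in> G j"
  shows "M v \<in> G (j + 1)"
proof (rule endo_maps_G[OF assms(1) subspace_G _ assms(3)])
  fix k v assume k: "k \<le> j" and v: "v \<in> eigenspace scale Y (\<theta>s k)"
  have "v \<in> G (j + 1)" "G (k + 1) \<subseteq> G (j + 1)"
    using k v Es_in_G G_mono by auto
  moreover have "M v = (M v - \<mu> k *s v) + \<mu> k *s v" by simp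
  ultimately show "M v \<in> G (j + 1)" using M[OF v] subspace_G[of "j + 1"]
    by (metis subspace_add subspace_scale subsetD)
qed

lemma X_F: "v \<in> F j \<Longrightarrow> X v - \<theta> j *s v \<in> F (j + 1)"
  by (rule F_shift[OF endo_X, where \<mu> = \<theta>]) (simp_all add: eigenspace_def subspace_0[OF subspace_F])

lemma Y_G: "v \<in> G j \<Longrightarrow> Y v - \<theta>s j *s v \<in> G (j - 1)"
  by (rule G_shift[OF endo_Y, where \<mu> = \<theta>s]) (simp_all add: eigenspace_def subspace_0[OF subspace_G])

lemma Y_F: assumes "v \<in> F j" shows "Y v \<in> F (j - 1)"
proof (rule F_widen[OF endo_Y _ assms, where \<mu> = "\<lambda>_. 0"])
  fix k v assume "v \<in> eigenspace scale X (\<theta> k)"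
  from E_tri[OF this] have "Y v \<in> F (k - 1)"
    unfolding F_def by (rule in_span_mono[rotated]) auto
  then show "Y v - 0 *s v \<in> F (k - 1)" by simp
qed

lemma X_G: assumes "v \<in> G j" shows "X v \<in> G (j + 1)"
proof (rule G_widen[OF endo_X _ assms, where \<mu> = "\<lambda>_. 0"])
  fix k v assume "v \<in> eigenspace scale Y (\<theta>s k)"
  from Es_tri[OF this] have "X v \<in> G (k + 1)"
    unfolding G_def by (rule in_span_mono[rotated]) auto
  then show "X v - 0 *s v \<in> G (k + 1)" by simp
qed

section \<open>Irreducibility and the direct sum of the \<open>U i\<close>\<close>

lemma X_GF:
  assumes "v \<in> G i \<inter> F j" shows "X v - \<theta> j *s v \<in> G (i + 1) \<inter> F (j + 1)"
  using assms X_F[of v j] X_G[of v i] G_mono[of i "i + 1"] subspace_G[of "i + 1"]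
  by (auto intro!: subspace_diff subspace_scale)

lemma Y_GF:
  assumes "v \<in> G i \<inter> F j" shows "Y v - \<theta>s i *s v \<in> G (i - 1) \<inter> F (j - 1)"
  using assms Y_F[of v j] Y_G[of v i] F_antimono[of "j - 1" j] subspace_F[of "j - 1"]
  by (auto intro!: subspace_diff subspace_scale)

text \<open>Modulo scalars, \<open>X\<close> raises both flag indices by one and \<open>Y\<close>
  lowers both by one, so the offset \<open>r\<close> between them is preserved and the sum over
  \<open>i\<close> is invariant.\<close>

lemma diagonal_sum_invariant:
  defines "W \<equiv> \<lambda>r. span (\<Union>i. G i \<inter> F (i + r))"
  shows "W r = {0} \<or> W r = UNIV"
proof (rule irred)
  show "subspace (W r)" by (simp add: W_def)
  show "X v \<in> W r" if "v \<in> W r" for v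
  proof (rule endo_maps_span[OF endo_X \<open>subspace (W r)\<close> _ that[unfolded W_def]])
    fix s assume "s \<in> (\<Union>i. G i \<inter> F (i + r))"
    then obtain i where s: "s \<in> G i \<inter> F (i + r)" by auto
    then have "X s - \<theta> (i + r) *s s \<in> G (i + 1) \<inter> F ((i + 1) + r)"
      using X_GF[OF s] by (simp add: algebra_simps)
    then have "X s - \<theta> (i + r) *s s \<in> W r" "s \<in> W r"
      using s unfolding W_def by (blast intro: span_base)+
    then show "X s \<in> W r"
      using subspace_add[OF \<open>subspace (W r)\<close> _ subspace_scale[OF \<open>subspace (W r)\<close>]]
      by (metis diff_add_cancel)
  qed
  show "Y v \<in> W r" if "v \<in> W r" for v
  proof (rule endo_maps_span[OF endo_Y \<open>subspace (W r)\<close> _ that[unfolded W_def]])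
    fix s assume "s \<in> (\<Union>i. G i \<inter> F (i + r))"
    then obtain i where s: "s \<in> G i \<inter> F (i + r)" by auto
    then have "Y s - \<theta>s i *s s \<in> G (i - 1) \<inter> F ((i - 1) + r)"
      using Y_GF[OF s] by (simp add: algebra_simps)
    then have "Y s - \<theta>s i *s s \<in> W r" "s \<in> W r"
      using s unfolding W_def by (blast intro: span_base)+
    then show "Y s \<in> W r"
      using subspace_add[OF \<open>subspace (W r)\<close> _ subspace_scale[OF \<open>subspace (W r)\<close>]]
      by (metis diff_add_cancel)
  qed
qed

text \<open>Otherwise an eigenvector for \<open>\<theta> 0\<close> lies in \<open>F 1\<close>. On it
  \<open>X - \<theta> j\<close> is a nonzero scalar for \<open>j \<ge> 1\<close>, yet maps
  \<open>F j\<close> into \<open>F (j + 1)\<close>; so it sinks through the flag down to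
  \<open>F (1 + d)\<close>, which is zero.\<close>

lemma F_1_neq_UNIV: "F 1 \<noteq> UNIV"
proof
  assume F1: "F 1 = UNIV"
  obtain v where v: "v \<noteq> 0" "v \<in> eigenspace scale X (\<theta> 0)"
    using E_nonzero[of 0] d_nonneg by auto
  have "v \<in> F (1 + int n)" for n
  proof (induction n)
    case 0
    then show ?case using F1 by simp
  next
    case (Suc n)
    let ?j = "1 + int n"
    have "X v - \<theta> ?j *s v \<in> F (?j + 1)" by (rule X_F) (rule Suc)
    moreover have "X v - \<theta> ?j *s v = (\<theta> 0 - \<theta> ?j) *s v"
      using v by (simp add: eigenspace_def algebra_simps)
    moreover have "\<theta> 0 \<noteq> \<theta> ?j" using injD[OF inj_\<theta>, of 0 ?j] by auto
    ultimately have nz: "\<theta> 0 \<noteq> \<theta> ?j" and "(\<theta> 0 - \<theta> ?j) *s v \<in> F (?j + 1)" by auto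
    from subspace_scale[OF subspace_F this(2), of "inverse (\<theta> 0 - \<theta> ?j)"] nz
    have "v \<in> F (?j + 1)" by simp
    then show ?case by (simp add: algebra_simps)
  qed
  from this[of "nat d"] have "v \<in> F (1 + d)" using d_nonneg by simp
  then show False using F_eq_0[of "1 + d"] v by simp
qed

text \<open>With the positive offset \<open>j - i\<close>, every summand of the invariant sum lies
  in \<open>F 1\<close>: either \<open>k < 0\<close> and \<open>G k\<close> is zero, or
  \<open>k + (j - i) \<ge> 1\<close>. The sum is therefore proper, hence zero.\<close>

lemma GF_disjoint: assumes "i < j" "v \<in> G i" "v \<in> F j" shows "v = 0"
proof -
  let ?W = "span (\<Union>k. G k \<inter> F (k + (j - i)))"
  have "G k \<inter> F (k + (j - i)) \<subseteq> F 1" for k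
  proof (cases "k < 0")
    case True
    then show ?thesis using G_eq_0 subspace_0[OF subspace_F] by auto
  next
    case False
    then show ?thesis using F_antimono[of 1 "k + (j - i)"] assms(1) by auto
  qed
  then have "?W \<subseteq> F 1" by (intro span_minimal subspace_F) auto
  then have "?W = {0}" using F_1_neq_UNIV diagonal_sum_invariant by blast
  moreover have "v \<in> ?W"
  proof (rule span_base)
    have "v \<in> G i \<inter> F (i + (j - i))" using assms by simp
    then show "v \<in> (\<Union>k. G k \<inter> F (k + (j - i)))" by blast
  qed
  ultimately show ?thesis by simp
qed

text \<open>For offset zero the invariant sum contains the nonzero eigenspace of
  \<open>\<theta>s 0\<close>, because \<open>F 0\<close> is the whole space.\<close>

lemma span_U: "span (\<Union>i. U i) = UNIV"
proof -
  obtain v where v: "v \<noteq> 0" "v \<in> eigenspace scale Y (\<theta>s 0)"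
    using Es_nonzero[of 0] d_nonneg by auto
  then have "v \<in> U 0" by (simp add: U_def F_eq_UNIV Es_in_G)
  then have "v \<in> span (\<Union>i. U i)" by (intro span_base) auto
  then show ?thesis using v diagonal_sum_invariant[of 0] by (auto simp: U_def)
qed

lemma U_outside: "\<not> (0 \<le> i \<and> i \<le> d) \<Longrightarrow> U i = {0}"
  using F_eq_0[of i] G_eq_0[of i] subspace_0[OF subspace_F] subspace_0[OF subspace_G]
  by (auto simp: U_def not_le)

lemma X_U: "v \<in> U i \<Longrightarrow> X v - \<theta> i *s v \<in> U (i + 1)"
  unfolding U_def by (rule X_GF)

lemma Y_U: "v \<in> U i \<Longrightarrow> Y v - \<theta>s i *s v \<in> U (i - 1)"
  unfolding U_def by (rule Y_GF)

lemma eq_on_U: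
  assumes "endo M" "endo N" "\<And>i v. v \<in> U i \<Longrightarrow> M v = N v"
  shows "M = N"
  by (rule endo_eq_on_span[OF assms(1,2) span_U]) (use assms(3) in auto)

lemma U_decompose: "\<exists>u. (\<forall>i. u i \<in> U i) \<and> v = (\<Sum>i\<in>{0..d}. u i)"
proof -
  have "v \<in> span (\<Union>i. U i)" by (simp add: span_U)
  then show ?thesis
  proof (induction rule: span_induct_alt)
    case base
    show ?case by (rule exI[of _ "\<lambda>_. 0"]) (simp add: subspace_0[OF subspace_U])
  next
    case (step c x y)
    then obtain u where u: "\<forall>i. u i \<in> U i" "y = (\<Sum>i\<in>{0..d}. u i)" by auto
    obtain k where k: "x \<in> U k" using step by auto
    show ?case
    proof (intro exI conjI allI)
      fix i
      show "(if i = k then c *s x else 0) + u i \<in> U i"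
        using k u by (auto intro!: subspace_add subspace_scale subspace_U)
    next
      have "x = 0" if "k \<notin> {0..d}" using that k U_outside[of k] by auto
      then show "c *s x + y = (\<Sum>i\<in>{0..d}. (if i = k then c *s x else 0) + u i)"
        using u by (auto simp: sum.distrib)
    qed
  qed
qed

text \<open>Take the largest \<open>n\<close> with \<open>u n\<close> nonzero. The other components
  and the whole sum lie in \<open>G (n - 1)\<close>, so \<open>u n\<close> does too; but it also
  lies in \<open>F n\<close>. The mirror image for \<open>F\<close> uses the smallest such
  index.\<close>

lemma U_components_G:
  assumes u: "\<And>i. u i \<in> U i" and s: "(\<Sum>i\<in>{0..d}. u i) \<in> G m" and "m < k"
  shows "u k = 0"
proof (rule ccontr)
  assume nz: "u k \<noteq> 0"
  let ?N = "{i \<in> {0..d}. u i \<noteq> 0}"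
  define n where "n = Max ?N"
  have "k \<in> {0..d}" using nz u[of k] U_outside[of k] by auto
  then have kN: "k \<in> ?N" using nz by simp
  have fin: "finite ?N" by (rule finite_subset[of _ "{0..d}"]) auto
  have n: "n \<in> ?N" unfolding n_def by (rule Max_in) (use kN fin in auto)
  have "k \<le> n" unfolding n_def by (rule Max_ge) (use kN fin in auto)
  have z: "u i = 0" if "i \<in> {0..d}" "n < i" for i
  proof (rule ccontr)
    assume "u i \<noteq> 0"
    then have "i \<le> n" unfolding n_def by (intro Max_ge) (use that fin in auto)
    then show False using that by simp
  qed
  have "u i \<in> G (n - 1)" if "i \<in> {0..d} - {n}" for i
  proof (cases "n < i")
    case True
    then show ?thesis using z that subspace_0[OF subspace_G] by auto
  next
    case False
    then show ?thesis using u[of i] G_mono[of i "n - 1"] that by (auto simp: U_def)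
  qed
  then have "(\<Sum>i\<in>{0..d} - {n}. u i) \<in> G (n - 1)"
    by (intro subspace_sum subspace_G)
  moreover have "(\<Sum>i\<in>{0..d}. u i) \<in> G (n - 1)"
    using s G_mono[of m "n - 1"] \<open>k \<le> n\<close> \<open>m < k\<close> by auto
  moreover have "u n = (\<Sum>i\<in>{0..d}. u i) - (\<Sum>i\<in>{0..d} - {n}. u i)"
    using n by (simp add: sum.remove[of "{0..d}" n])
  ultimately have "u n \<in> G (n - 1)" using subspace_diff[OF subspace_G] by simp
  then have "u n = 0" using GF_disjoint[of "n - 1" n] u[of n] by (auto simp: U_def)
  then show False using n by simp
qed

lemma U_components_F:
  assumes u: "\<And>i. u i \<in> U i" and s: "(\<Sum>i\<in>{0..d}. u i) \<in> F m" and "k < m"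
  shows "u k = 0"
proof (rule ccontr)
  assume nz: "u k \<noteq> 0"
  let ?N = "{i \<in> {0..d}. u i \<noteq> 0}"
  define n where "n = Min ?N"
  have "k \<in> {0..d}" using nz u[of k] U_outside[of k] by auto
  then have kN: "k \<in> ?N" using nz by simp
  have fin: "finite ?N" by (rule finite_subset[of _ "{0..d}"]) auto
  have n: "n \<in> ?N" unfolding n_def by (rule Min_in) (use kN fin in auto)
  have "n \<le> k" unfolding n_def by (rule Min_le) (use kN fin in auto)
  have z: "u i = 0" if "i \<in> {0..d}" "i < n" for i
  proof (rule ccontr)
    assume "u i \<noteq> 0"
    then have "n \<le> i" unfolding n_def by (intro Min_le) (use that fin in auto)
    then show False using that by simp
  qed
  have "u i \<in> F (n + 1)" if "i \<in> {0..d} - {n}" for i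
  proof (cases "i < n")
    case True
    then show ?thesis using z that subspace_0[OF subspace_F] by auto
  next
    case False
    then show ?thesis using u[of i] F_antimono[of "n + 1" i] that by (auto simp: U_def)
  qed
  then have "(\<Sum>i\<in>{0..d} - {n}. u i) \<in> F (n + 1)"
    by (intro subspace_sum subspace_F)
  moreover have "(\<Sum>i\<in>{0..d}. u i) \<in> F (n + 1)"
    using s F_antimono[of "n + 1" m] \<open>n \<le> k\<close> \<open>k < m\<close> by auto
  moreover have "u n = (\<Sum>i\<in>{0..d}. u i) - (\<Sum>i\<in>{0..d} - {n}. u i)"
    using n by (simp add: sum.remove[of "{0..d}" n])
  ultimately have "u n \<in> F (n + 1)" using subspace_diff[OF subspace_F] by simp
  then have "u n = 0" using GF_disjoint[of n "n + 1"] u[of n] by (auto simp: U_def)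
  then show False using n by simp
qed

text \<open>Membership in \<open>F l\<close> kills the components below \<open>l\<close>, membership
  in \<open>G m\<close> those above \<open>m\<close>.\<close>

lemma GF_in_span_U:
  assumes "v \<in> G m" "v \<in> F l"
  shows "v \<in> span (\<Union>k\<in>{l..m}. U k)"
proof -
  obtain u where u: "\<And>i. u i \<in> U i" "v = (\<Sum>i\<in>{0..d}. u i)" using U_decompose by blast
  have "u i \<in> span (\<Union>k\<in>{l..m}. U k)" for i
  proof (cases "i \<in> {l..m}")
    case True
    then show ?thesis using u by (intro span_base) blast
  next
    case False
    then have "u i = 0" using U_components_G[of u m i] U_components_F[of u l i] u assms by auto
    then show ?thesis by (simp add: span_zero)
  qed
  then show ?thesis using u(2) by (auto intro: span_sum)
qed

lemma ex_diagonal_on_U: "\<exists>M. endo M \<and> (\<forall>i. \<forall>v\<in>U i. M v = \<mu> i *s v)"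
proof -
  \<comment> \<open>Demanding \<open>u i \<in> U i\<close> for every integer \<open>i\<close>, also
    outside \<open>0..d\<close>, forces zeros there and makes \<open>u\<close> unique as a function;
    this gives linearity of the components.\<close>
  define D where "D v u \<longleftrightarrow> (\<forall>i. u i \<in> U i) \<and> v = (\<Sum>i\<in>{0..d}. u i)" for v u
  have D_unique: "u = u'" if "D v u" "D v u'" for v u u'
  proof
    fix k
    show "u k = u' k"
    proof (cases "k < 0")
      case True
      then show ?thesis using that U_outside[of k] unfolding D_def by (metis singletonD not_le)
    next
      case False
      have "(\<Sum>i\<in>{0..d}. u i - u' i) = 0" using that by (simp add: D_def sum_subtractf)
      \<comment> \<open>Directness of the sum is the case \<open>m = -1\<close>, where
        \<open>G m\<close> is zero.\<close>
      then have "u k - u' k = 0"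
        using False that by (intro U_components_G[of "\<lambda>i. u i - u' i" "-1" k])
          (auto simp: D_def subspace_0[OF subspace_G] intro!: subspace_diff subspace_U)
      then show ?thesis by simp
    qed
  qed
  define c where "c v = (SOME u. D v u)" for v
  have Dc: "D v (c v)" for v
    unfolding c_def using U_decompose[of v] by (intro someI_ex[of "D v"]) (simp add: D_def)
  have c: "c v = u" if "D v u" for v u using D_unique Dc that by blast
  have c_add: "c (x + y) = (\<lambda>i. c x i + c y i)" for x y
    using Dc[of x] Dc[of y] by (intro c) (auto simp: D_def sum.distrib intro!: subspace_add subspace_U)
  have c_scale: "c (r *s x) = (\<lambda>i. r *s c x i)" for r x
    using Dc[of x] by (intro c) (auto simp: D_def scale_sum_right[symmetric] intro!: subspace_scale subspace_U)
  let ?M = "\<lambda>v. \<Sum>i\<in>{0..d}. \<mu> i *s c v i"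
  show ?thesis
  proof (intro exI[of _ ?M] conjI allI ballI)
    show "endo ?M"
      by (rule endoI)
        (simp_all add: c_add c_scale scale_right_distrib sum.distrib scale_sum_right mult.commute)
    fix k v assume v: "v \<in> U k"
    then have out: "v = 0" if "k \<notin> {0..d}" using that U_outside[of k] by auto
    have "c v = (\<lambda>i. if i = k then v else 0)"
      by (rule c) (use v out in \<open>auto simp: D_def subspace_0[OF subspace_U]\<close>)
    then show "?M v = \<mu> k *s v"
      using out by (auto simp: if_distrib[of "\<lambda>x. _ *s x"] cong: if_cong)
  qed
qed

section \<open>Reversing an ordering and exchanging the two maps\<close>

lemma reindex_window:
  fixes S :: "int \<Rightarrow> 'v set"
  shows "(\<Union>k\<in>{i - 1..i + 1}. S (d - k)) = (\<Union>k\<in>{(d - i) - 1..(d - i) + 1}. S k)"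
proof -
  have "{(d - i) - 1..(d - i) + 1} = (\<lambda>k. d - k) ` {i - 1..i + 1}"
  proof (intro equalityI subsetI)
    fix x assume "x \<in> {(d - i) - 1..(d - i) + 1}"
    then show "x \<in> (\<lambda>k. d - k) ` {i - 1..i + 1}" by (intro image_eqI[of _ _ "d - x"]) auto
  qed auto
  then show ?thesis by (simp only: image_image)
qed

lemma reindex_all:
  fixes S :: "int \<Rightarrow> 'v set"
  shows "(\<Union>k. S (d - k)) = (\<Union>k. S k)"
proof -
  have "range (\<lambda>k. d - k) = UNIV" by (rule surjI[of _ "\<lambda>k. d - k"]) simp
  then show ?thesis by (metis image_image)
qed

text \<open>The window \<open>i - 1..i + 1\<close> is symmetric, so tridiagonality survives
  reversal. This yields further decompositions of the same space.\<close>

lemma split_pair_reverse: "split_pair scale X Y (\<lambda>i. \<theta> (d - i)) \<theta>s d"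
proof (intro split_pair.intro split_pair_axioms.intro endomorphisms_axioms)
  show "inj (\<lambda>i. \<theta> (d - i))" using inj_\<theta> by (auto dest!: injD intro!: injI)
  show "span (\<Union>i. eigenspace scale X (\<theta> (d - i))) = UNIV"
    using E_span reindex_all[of "\<lambda>i. eigenspace scale X (\<theta> i)"] by simp
  fix v i assume "v \<in> eigenspace scale X (\<theta> (d - i))"
  from E_tri[OF this]
  show "Y v \<in> span (\<Union>k\<in>{i - 1..i + 1}. eigenspace scale X (\<theta> (d - k)))"
    by (simp only: reindex_window[of "\<lambda>i. eigenspace scale X (\<theta> i)"])
next
  show "\<exists>v. v \<noteq> 0 \<and> v \<in> eigenspace scale X (\<theta> (d - i))" if "0 \<le> i" "i \<le> d" for i
    using that by (intro E_nonzero) auto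
  show "eigenspace scale X (\<theta> (d - i)) = {0}" if "\<not> (0 \<le> i \<and> i \<le> d)" for i
    using that by (intro E_outside) auto
qed (fact d_nonneg endo_X endo_Y inj_\<theta>s Es_outside Es_nonzero Es_span Es_tri | rule irred; simp)+

lemma split_pair_swap: "split_pair scale Y X \<theta>s \<theta> d"
  by (intro split_pair.intro split_pair_axioms.intro endomorphisms_axioms)
    (fact d_nonneg endo_X endo_Y inj_\<theta> inj_\<theta>s E_outside Es_outside E_nonzero Es_nonzero E_span Es_span
      E_tri Es_tri | rule irred; simp)+

end

section \<open>q-commutation relations\<close>

context endomorphisms
begin

definition arrow :: "'K \<Rightarrow> ('v \<Rightarrow> 'v) \<Rightarrow> ('v \<Rightarrow> 'v) \<Rightarrow> bool" where
  "arrow q f g \<longleftrightarrow> (\<forall>v. q *s f (g v) - inverse q *s g (f v) = (q - inverse q) *s v)"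

definition serre :: "'K \<Rightarrow> ('v \<Rightarrow> 'v) \<Rightarrow> ('v \<Rightarrow> 'v) \<Rightarrow> bool" where
  "serre q x y \<longleftrightarrow> (\<forall>v. x (x (x (y v))) - qint3 q *s x (x (y (x v)))
     + qint3 q *s x (y (x (x v))) - y (x (x (x v))) = 0)"

text \<open>Negating the relation exchanges the roles of \<open>q\<close> and
  \<open>inverse q\<close>; statements about one direction of an arrow thus give the other.\<close>

lemma arrow_inverse: "arrow (inverse q) f g \<longleftrightarrow> arrow q g f"
proof -
  have "inverse q *s f (g v) - q *s g (f v) = (inverse q - q) *s v
     \<longleftrightarrow> q *s g (f v) - inverse q *s f (g v) = (q - inverse q) *s v" for v
    by (metis minus_diff_eq scale_minus_left)
  then show ?thesis by (simp add: arrow_def)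
qed

text \<open>Solving the relation gives
  \<open>f (g v) = (1 - inverse (q^2)) w + inverse (q^2) l g v\<close>; subtracting
  \<open>inverse l *s w\<close> from \<open>g v\<close> absorbs the inhomogeneous term.\<close>

lemma eigenspace_shift:
  assumes "endo f" "q \<noteq> 0" "l \<noteq> 0"
    and v: "v \<in> eigenspace scale f l" and w: "w \<in> eigenspace scale f l"
    and rel: "q *s f (g v) - inverse q *s g (f v) = (q - inverse q) *s w" and g: "endo g"
  shows "g v - inverse l *s w \<in> eigenspace scale f (inverse (q\<^sup>2) * l)"
proof -
  have "q *s f (g v) = (q - inverse q) *s w + (inverse q * l) *s g v"
    using rel v by (simp add: eigenspace_def endo_scale[OF g] algebra_simps)
  then have "inverse q *s (q *s f (g v)) = inverse q *s ((q - inverse q) *s w + (inverse q * l) *s g v)"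
    by simp
  then have "f (g v) = (1 - inverse q * inverse q) *s w + (inverse q * inverse q * l) *s g v"
    using assms(2) by (simp add: scale_right_distrib algebra_simps)
  moreover have l: "l * (inverse l * x) = x" for x
    using assms(3) by (simp add: mult.assoc[symmetric])
  ultimately show ?thesis
    using w assms(3) by (simp add: eigenspace_def endo_simps[OF assms(1)] l algebra_simps power2_eq_square)
qed

lemma arrow_eigenspace_right:
  assumes "arrow q f g" "endo f" "endo g" "q \<noteq> 0" "v \<in> eigenspace scale f (q powi n)"
  shows "g v - q powi (- n) *s v \<in> eigenspace scale f (q powi (n - 2))"
proof -
  have "inverse (q\<^sup>2) * q powi n = q powi (n - 2)"
    using assms(4) by (simp add: power_int_diff divide_inverse mult.commute)
  then show ?thesis
    using eigenspace_shift[OF assms(2,4) _ assms(5,5) _ assms(3)] assms(1,4)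
    by (simp add: arrow_def power_int_minus)
qed

lemma arrow_eigenspace_left:
  assumes "arrow q g f" "endo f" "endo g" "q \<noteq> 0" "v \<in> eigenspace scale f (q powi n)"
  shows "g v - q powi (- n) *s v \<in> eigenspace scale f (q powi (n + 2))"
proof -
  have *: "inverse q powi m = q powi (- m)" for m
    by (simp add: power_int_minus power_int_inverse)
  show ?thesis
    using arrow_eigenspace_right[of "inverse q" f g v "- n"] assms
    by (simp add: arrow_inverse * add.commute)
qed

text \<open>A pointwise converse of the eigenspace shifts, by which the relations are verified for
  maps \<open>M\<close> constructed as scalars on a decomposition.\<close>

lemma arrow_right_at:
  assumes "endo f" "endo M" "m \<noteq> 0" "q \<noteq> 0" "M v = m *s v"
    and "M (f v - inverse m *s v) = (q\<^sup>2 * m) *s (f v - inverse m *s v)"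
  shows "q *s f (M v) - inverse q *s M (f v) = (q - inverse q) *s v"
proof -
  have "M (f v) = (q\<^sup>2 * m) *s (f v - inverse m *s v) + v"
    using assms by (simp add: endo_diff[OF assms(2)] endo_scale[OF assms(2)] algebra_simps)
  then have "inverse q *s M (f v) = inverse q *s ((q\<^sup>2 * m) *s (f v - inverse m *s v) + v)" by simp
  also have "\<dots> = (inverse q * (q\<^sup>2 * m)) *s f v
      - (inverse q * (q\<^sup>2 * m * inverse m)) *s v + inverse q *s v"
    by (simp add: scale_right_distrib scale_right_diff_distrib mult.assoc)
  also have "inverse q * (q\<^sup>2 * m) = q * m"
    using assms by (simp add: field_simps power2_eq_square)
  also have "inverse q * (q\<^sup>2 * m * inverse m) = q"
    using assms by (simp add: field_simps power2_eq_square)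
  finally show ?thesis
    using assms(5) by (simp add: endo_scale[OF assms(1)] scale_left_diff_distrib)
qed

lemma arrow_left_at:
  assumes "endo f" "endo M" "m \<noteq> 0" "q \<noteq> 0" "M v = m *s v"
    and "M (f v - inverse m *s v) = (inverse (q\<^sup>2) * m) *s (f v - inverse m *s v)"
  shows "q *s M (f v) - inverse q *s f (M v) = (q - inverse q) *s v"
  using arrow_right_at[of f M m "inverse q" v] assms
  by (simp add: power_inverse scale_left_diff_distrib algebra_simps)

text \<open>On the \<open>b\<close>-component of \<open>y v\<close>, where \<open>x v = a v\<close>, the Serre expression acts as
  \<open>(b - a) (b - q\<^sup>2 a) (b - q\<^sup>-\<^sup>2 a)\<close>, so it vanishes once \<open>b / a\<close> is \<open>1\<close> or \<open>q\<^sup>\<plusminus>\<^sup>2\<close>.\<close>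

lemma serre_if_tridiagonal:
  assumes x: "endo x" and y: "endo y" and "q \<noteq> 0" "q\<^sup>2 \<noteq> 1"
    and span: "span (\<Union>i. S i) = UNIV"
    and eig: "\<And>i v. v \<in> S i \<Longrightarrow> x v = e i *s v"
    and tri: "\<And>i v. v \<in> S i \<Longrightarrow> y v \<in> span (\<Union>k\<in>{i - 1..i + 1::int}. S k)"
    and cubic: "\<And>i k. k \<in> {i - 1..i + 1} \<Longrightarrow>
      (e k - e i) * (e k - q\<^sup>2 * e i) * (e k - inverse (q\<^sup>2) * e i) = 0"
  shows "serre q x y"
proof -
  define t where "t = qint3 q"
  \<comment> \<open>In this form the cubic below factors.\<close>
  have t: "t = q\<^sup>2 + 1 + inverse (q\<^sup>2)"
  proof -
    have "q - inverse q \<noteq> 0" using assms(3,4) by (simp add: field_simps power2_eq_square)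
    then show ?thesis using assms(3)
      by (simp add: t_def qint3_def divide_simps) (simp add: algebra_simps power2_eq_square power3_eq_cube eval_nat_numeral)
  qed
  let ?s = "\<lambda>v. x (x (x (y v))) - t *s x (x (y (x v))) + t *s x (y (x (x v))) - y (x (x (x v)))"
  have endos: "endo ?s" by (rule endoI) (simp_all add: x y endo_simps algebra_simps)
  have "?s v \<in> {0}" for v
  proof (rule endo_maps_span[OF endos subspace_single_0])
    show "v \<in> span (\<Union>i. S i)" by (simp add: span)
    fix v assume "v \<in> (\<Union>i. S i)"
    then obtain i where v: "v \<in> S i" by auto
    let ?a = "e i"
    \<comment> \<open>The Serre expression at \<open>v\<close>, with each \<open>x\<close> to the
      right of \<open>y\<close> replaced by its eigenvalue: a cubic polynomial in \<open>x\<close>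
      applied to \<open>y v\<close>.\<close>
    let ?L = "\<lambda>w. x (x (x w)) - (t * ?a) *s x (x w) + (t * ?a\<^sup>2) *s x w - ?a ^ 3 *s w"
    have "?L (y v) \<in> {0}"
    proof (rule endo_maps_span[OF _ subspace_single_0 _ tri[OF v]])
      show "endo ?L" by (rule endoI) (simp_all add: x endo_simps algebra_simps)
      fix w assume "w \<in> (\<Union>k\<in>{i - 1..i + 1}. S k)"
      then obtain k where k: "k \<in> {i - 1..i + 1}" "w \<in> S k" by auto
      have "?L w = (e k ^ 3 - t * ?a * (e k)\<^sup>2 + t * ?a\<^sup>2 * e k - ?a ^ 3) *s w"
        using eig[OF k(2)] by (simp add: endo_scale[OF x] algebra_simps power2_eq_square power3_eq_cube)
      also have "e k ^ 3 - t * ?a * (e k)\<^sup>2 + t * ?a\<^sup>2 * e k - ?a ^ 3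
          = (e k - e i) * (e k - q\<^sup>2 * e i) * (e k - inverse (q\<^sup>2) * e i)"
        using assms(3) unfolding t by (simp add: field_simps power2_eq_square power3_eq_cube)
      finally show "?L w \<in> {0}" using cubic[OF k(1)] by simp
    qed
    then show "?s v \<in> {0}"
      using eig[OF v] by (simp add: endo_scale[OF x] endo_scale[OF y] algebra_simps power2_eq_square power3_eq_cube)
  qed
  then show ?thesis by (simp add: serre_def t_def)
qed

end

lemma (in split_pair) arrowI:
  assumes "endo f" "endo g"
    and "\<And>i v. v \<in> U i \<Longrightarrow> q *s f (g v) - inverse q *s g (f v) = (q - inverse q) *s v"
  shows "arrow q f g"
proof -
  have "(\<lambda>v. q *s f (g v) - inverse q *s g (f v)) = (\<lambda>v. (q - inverse q) *s v)"
    by (rule eq_on_U) (auto intro!: endoI simp: assms endo_simps algebra_simps)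
  then show ?thesis unfolding arrow_def by meson
qed

section \<open>Pairs whose eigenvalues are normalised to powers of \<open>q\<close>\<close>

locale q_pair = endomorphisms scale
  for scale :: "'K::field \<Rightarrow> 'v::ab_group_add \<Rightarrow> 'v" (infixr "*s" 75) +
  fixes q :: 'K and X Y :: "'v \<Rightarrow> 'v" and d :: int
  assumes q_nonzero: "q \<noteq> 0" and q_square: "q\<^sup>2 \<noteq> 1"
    and split: "split_pair scale X Y (\<lambda>i. q powi (2 * i - d)) (\<lambda>i. q powi (d - 2 * i)) d"
begin

sublocale sp: split_pair scale X Y "\<lambda>i. q powi (2 * i - d)" "\<lambda>i. q powi (d - 2 * i)" d
  by (fact split)

text \<open>\<open>sp\<close> keeps the given orderings and its summands carry \<open>K\<close>;
  \<open>sr\<close> reverses the ordering of \<open>X\<close> and its summands carry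
  \<open>P\<close>.\<close>

sublocale sr: split_pair scale X Y "\<lambda>i. q powi (d - 2 * i)" "\<lambda>i. q powi (d - 2 * i)" d
  using sp.split_pair_reverse by (simp add: algebra_simps)

lemmas endo_X = sp.endo_X and endo_Y = sp.endo_Y

lemma powi_cong_times: "n = m + 2 \<Longrightarrow> q powi n = q\<^sup>2 * q powi m"
  using q_nonzero by (simp add: power_int_add)

lemma powi_cong_div: "n = m - 2 \<Longrightarrow> q powi n = inverse (q\<^sup>2) * q powi m"
  using q_nonzero by (simp add: power_int_diff divide_inverse)

lemma inverse_powi: "m = - n \<Longrightarrow> inverse (q powi n) = q powi m"
  by (simp add: power_int_minus)

lemma powi_cubic:
  assumes "k \<in> {i - 1..i + 1}"
  shows "(q powi (2 * k - d) - q powi (2 * i - d)) * (q powi (2 * k - d) - q\<^sup>2 * q powi (2 * i - d))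
      * (q powi (2 * k - d) - inverse (q\<^sup>2) * q powi (2 * i - d)) = 0"
proof -
  consider "k = i" | "k = i + 1" | "k = i - 1" using assms by force
  then show ?thesis
  proof cases
    case 2
    then show ?thesis using powi_cong_times[of "2 * k - d" "2 * i - d"] by simp
  next
    case 3
    then show ?thesis using powi_cong_div[of "2 * k - d" "2 * i - d"] by simp
  qed simp
qed

text \<open>Reversing both orderings interchanges the exponents \<open>2 * i - d\<close> and
  \<open>d - 2 * i\<close>. Results about \<open>P\<close> then apply to \<open>Q\<close> with
  \<open>X\<close> and \<open>Y\<close> exchanged.\<close>

lemma q_pair_swap: "q_pair scale q Y X d"
proof -
  have "split_pair scale Y X (\<lambda>i. q powi (2 * i - d)) (\<lambda>i. q powi (d - 2 * i)) d"
    using split_pair.split_pair_reverse[OF sr.split_pair_swap] by (simp add: algebra_simps)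
  then show ?thesis
    using q_nonzero q_square by (simp add: q_pair_def q_pair_axioms_def endomorphisms_axioms)
qed

text \<open>Reversing both orderings has the same effect on the exponents as replacing
  \<open>q\<close> by its inverse.\<close>

lemma q_pair_inverse: "q_pair scale (inverse q) X Y d"
proof -
  have "split_pair scale Y X (\<lambda>i. q powi (2 * i - d)) (\<lambda>i. q powi (d - 2 * i)) d"
    using split_pair.split_pair_reverse[OF sr.split_pair_swap] by (simp add: algebra_simps)
  from split_pair.split_pair_swap[OF this]
  have "split_pair scale X Y (\<lambda>i. q powi (d - 2 * i)) (\<lambda>i. q powi (2 * i - d)) d" .
  moreover have "inverse q powi n = q powi (- n)" for n
    by (simp add: power_int_minus power_int_inverse)
  ultimately show ?thesis
    using q_nonzero q_square
    by (simp add: q_pair_def q_pair_axioms_def endomorphisms_axioms power_inverse)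
qed

section \<open>Uniqueness and existence of \<open>P\<close> and \<open>K\<close>\<close>

abbreviation "VX k \<equiv> eigenspace scale X (q powi (2 * k - d))"
abbreviation "VY k \<equiv> eigenspace scale Y (q powi (d - 2 * k))"

lemma X_arrow_VX:
  assumes "endo P" "arrow q X P" "v \<in> VX k"
  shows "P v - q powi (d - 2 * k) *s v \<in> VX (k - 1)"
  using arrow_eigenspace_right[OF assms(2) endo_X assms(1) q_nonzero assms(3)] by (simp add: algebra_simps)

lemma arrow_X_VX:
  assumes "endo K" "arrow q K X" "v \<in> VX k"
  shows "K v - q powi (d - 2 * k) *s v \<in> VX (k + 1)"
  using arrow_eigenspace_left[OF assms(2) endo_X assms(1) q_nonzero assms(3)] by (simp add: algebra_simps)

lemma arrow_Y_VY:
  assumes "endo P" "arrow q P Y" "v \<in> VY k"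
  shows "P v - q powi (2 * k - d) *s v \<in> VY (k - 1)"
  using arrow_eigenspace_left[OF assms(2) endo_Y assms(1) q_nonzero assms(3)] by (simp add: algebra_simps)

lemma Y_arrow_VY:
  assumes "endo Q" "arrow q Y Q" "v \<in> VY k"
  shows "Q v - q powi (2 * k - d) *s v \<in> VY (k + 1)"
  using arrow_eigenspace_right[OF assms(2) endo_Y assms(1) q_nonzero assms(3)] by (simp add: algebra_simps)

text \<open>The arrow from \<open>X\<close> pushes \<open>P\<close> minus the scalar one step down
  the flag \<open>sr.F\<close>, the arrow to \<open>Y\<close> one step down \<open>sr.G\<close>; the
  result lies in \<open>sr.G (i - 1)\<close> and \<open>sr.F (i + 1)\<close>, which meet in
  zero.\<close>

lemma P_on_U:
  assumes "endo P" "arrow q X P" "arrow q P Y" and v: "v \<in> sr.U i"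
  shows "P v = q powi (2 * i - d) *s v"
proof -
  have "P v - q powi (2 * i - d) *s v \<in> sr.F (i + 1)"
  proof (rule sr.F_shift[OF assms(1)])
    fix k v assume "v \<in> eigenspace scale X (q powi (d - 2 * k))"
    \<comment> \<open>\<open>VX\<close> refers to the original ordering, so the index
      \<open>k\<close> of \<open>sr\<close> becomes \<open>d - k\<close>.\<close>
    then have "v \<in> VX (d - k)" by (simp add: algebra_simps)
    from X_arrow_VX[OF assms(1,2) this]
    have "P v - q powi (2 * k - d) *s v \<in> eigenspace scale X (q powi (d - 2 * (k + 1)))"
      by (simp add: algebra_simps)
    then show "P v - q powi (2 * k - d) *s v \<in> sr.F (k + 1)" by (rule sr.E_in_F) simp
  qed (use v in \<open>simp add: sr.U_def\<close>)
  moreover have "P v - q powi (2 * i - d) *s v \<in> sr.G (i - 1)"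
    by (rule sr.G_shift[OF assms(1) sr.Es_in_G[OF arrow_Y_VY[OF assms(1,3)] order_refl]])
      (use v in \<open>simp_all add: sr.U_def\<close>)
  ultimately show ?thesis using sr.GF_disjoint[of "i - 1" "i + 1"] by fastforce
qed

lemma P_unique:
  assumes "endo P" "arrow q X P" "arrow q P Y" "endo P'" "arrow q X P'" "arrow q P' Y"
  shows "P = P'"
  by (rule sr.eq_on_U[OF assms(1,4)]) (simp add: P_on_U[OF assms(1-3)] P_on_U[OF assms(4-6)])

text \<open>With the forced scalars, \<open>X\<close> and \<open>Y\<close> minus their own scalars
  move \<open>sr.U i\<close> to a neighbour on which the scalar of \<open>P\<close> is multiplied by
  \<open>q^2\<close> or its inverse, as the arrows require.\<close>

lemma P_exists: "\<exists>P. endo P \<and> arrow q X P \<and> arrow q P Y"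
proof -
  obtain P where P: "endo P" and Pv: "\<And>i v. v \<in> sr.U i \<Longrightarrow> P v = q powi (2 * i - d) *s v"
    using sr.ex_diagonal_on_U[of "\<lambda>i. q powi (2 * i - d)"] by auto
  have "arrow q X P"
  proof (rule sr.arrowI[OF endo_X P], rule arrow_right_at[OF endo_X P])
    fix i v assume v: "v \<in> sr.U i"
    show "P v = q powi (2 * i - d) *s v" by (rule Pv[OF v])
    show "P (X v - inverse (q powi (2 * i - d)) *s v)
      = (q\<^sup>2 * q powi (2 * i - d)) *s (X v - inverse (q powi (2 * i - d)) *s v)"
      using Pv[OF sr.X_U[OF v]] inverse_powi[of "d - 2 * i" "2 * i - d"]
        powi_cong_times[of "2 * (i + 1) - d" "2 * i - d"] by simp
  qed (simp_all add: q_nonzero)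
  moreover have "arrow q P Y"
  proof (rule sr.arrowI[OF P endo_Y], rule arrow_left_at[OF endo_Y P])
    fix i v assume v: "v \<in> sr.U i"
    show "P v = q powi (2 * i - d) *s v" by (rule Pv[OF v])
    show "P (Y v - inverse (q powi (2 * i - d)) *s v)
      = (inverse (q\<^sup>2) * q powi (2 * i - d)) *s (Y v - inverse (q powi (2 * i - d)) *s v)"
      using Pv[OF sr.Y_U[OF v]] inverse_powi[of "d - 2 * i" "2 * i - d"]
        powi_cong_div[of "2 * (i - 1) - d" "2 * i - d"] by simp
  qed (simp_all add: q_nonzero)
  ultimately show ?thesis using P by blast
qed

lemma K_on_U:
  assumes "endo K" "endo K'" "\<And>v. K (K' v) = v" "arrow q K X" "arrow q K' Y" and v: "v \<in> sp.U i"
  shows "K v = q powi (d - 2 * i) *s v"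
proof -
  have "K v - q powi (d - 2 * i) *s v \<in> sp.F (i + 1)"
    by (rule sp.F_shift[OF assms(1) sp.E_in_F[OF arrow_X_VX[OF assms(1,4)] order_refl]])
      (use v in \<open>simp_all add: sp.U_def\<close>)
  \<comment> \<open>Only the inverse \<open>K'\<close> has an arrow to \<open>Y\<close>, so for
    \<open>K\<close> mere invariance of \<open>G\<close> is shown, by applying \<open>K\<close> to
    \<open>K' v = c v + w\<close> with \<open>w\<close> one step lower. The offset
    \<open>- 1\<close> starts the induction at the zero space.\<close>
  moreover have "K v \<in> sp.G (int n - 1)" if "v \<in> sp.G (int n - 1)" for n v
    using that
  proof (induction n arbitrary: v)
    case 0
    then show ?case using sp.G_eq_0[of "-1"] by (simp add: endo_zero[OF assms(1)])
  next
    case (Suc n)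
    let ?i = "int (Suc n) - 1" and ?w = "K' v - q powi (2 * (int (Suc n) - 1) - d) *s v"
    have "?w \<in> sp.G (?i - 1)"
      by (rule sp.G_shift[OF assms(2) sp.Es_in_G[OF arrow_Y_VY[OF assms(2,5)] order_refl] Suc.prems]) auto
    then have "K ?w \<in> sp.G ?i" using Suc.IH[of ?w] sp.G_mono[of "int n - 1" ?i] by auto
    then have *: "v - K ?w \<in> sp.G ?i" using Suc.prems by (intro subspace_diff sp.subspace_G)
    moreover have "v - K ?w = q powi (2 * ?i - d) *s K v"
      by (simp add: endo_simps[OF assms(1)] assms(3))
    ultimately have "q powi (2 * ?i - d) *s K v \<in> sp.G ?i" by simp
    from subspace_scale[OF sp.subspace_G this, of "inverse (q powi (2 * ?i - d))"]
    show ?case using q_nonzero by simp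
  qed
  from this[of v "nat (i + 1)"] have KG: "K v \<in> sp.G i" if "0 \<le> i" using that v by (simp add: sp.U_def)
  have "K v - q powi (d - 2 * i) *s v \<in> sp.G i"
  proof (cases "0 \<le> i")
    case True
    then show ?thesis
      using KG v by (intro subspace_diff subspace_scale sp.subspace_G) (simp_all add: sp.U_def)
  next
    case False
    then have "v = 0" using v sp.U_outside[of i] by simp
    then show ?thesis by (simp add: endo_zero[OF assms(1)] subspace_0[OF sp.subspace_G])
  qed
  ultimately show ?thesis using sp.GF_disjoint[of i "i + 1"] by fastforce
qed

lemma K_unique:
  assumes "endo K" "endo K'" "\<And>v. K (K' v) = v" "arrow q K X" "arrow q K' Y"
    and "endo L" "endo L'" "\<And>v. L (L' v) = v" "arrow q L X" "arrow q L' Y"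
  shows "K = L"
  by (rule sp.eq_on_U[OF assms(1,6)]) (simp add: K_on_U[OF assms(1-5)] K_on_U[OF assms(6-10)])

lemma K_exists:
  "\<exists>K K'. endo K \<and> endo K' \<and> (\<forall>v. K (K' v) = v) \<and> (\<forall>v. K' (K v) = v) \<and> arrow q K X \<and> arrow q K' Y"
proof -
  obtain K where K: "endo K" and Kv: "\<And>i v. v \<in> sp.U i \<Longrightarrow> K v = q powi (d - 2 * i) *s v"
    using sp.ex_diagonal_on_U[of "\<lambda>i. q powi (d - 2 * i)"] by auto
  obtain K' where K': "endo K'" and K'v: "\<And>i v. v \<in> sp.U i \<Longrightarrow> K' v = q powi (2 * i - d) *s v"
    using sp.ex_diagonal_on_U[of "\<lambda>i. q powi (2 * i - d)"] by auto
  have inv: "q powi (2 * i - d) * q powi (d - 2 * i) = 1" "q powi (d - 2 * i) * q powi (2 * i - d) = 1" for i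
    using q_nonzero by (simp_all add: power_int_add[symmetric])
  have i1: "(\<lambda>v. K (K' v)) = (\<lambda>v. v)"
    by (rule sp.eq_on_U) (auto intro!: endoI simp: K K' endo_simps Kv K'v inv)
  have i2: "(\<lambda>v. K' (K v)) = (\<lambda>v. v)"
    by (rule sp.eq_on_U) (auto intro!: endoI simp: K K' endo_simps Kv K'v inv)
  have KX: "arrow q K X"
  proof (rule sp.arrowI[OF K endo_X], rule arrow_left_at[OF endo_X K])
    fix i v assume v: "v \<in> sp.U i"
    show "K v = q powi (d - 2 * i) *s v" by (rule Kv[OF v])
    show "K (X v - inverse (q powi (d - 2 * i)) *s v)
      = (inverse (q\<^sup>2) * q powi (d - 2 * i)) *s (X v - inverse (q powi (d - 2 * i)) *s v)"
      using Kv[OF sp.X_U[OF v]] inverse_powi[of "2 * i - d" "d - 2 * i"]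
        powi_cong_div[of "d - 2 * (i + 1)" "d - 2 * i"] by simp
  qed (simp_all add: q_nonzero)
  have KY: "arrow q K' Y"
  proof (rule sp.arrowI[OF K' endo_Y], rule arrow_left_at[OF endo_Y K'])
    fix i v assume v: "v \<in> sp.U i"
    show "K' v = q powi (2 * i - d) *s v" by (rule K'v[OF v])
    show "K' (Y v - inverse (q powi (2 * i - d)) *s v)
      = (inverse (q\<^sup>2) * q powi (2 * i - d)) *s (Y v - inverse (q powi (2 * i - d)) *s v)"
      using K'v[OF sp.Y_U[OF v]] inverse_powi[of "d - 2 * i" "2 * i - d"]
        powi_cong_div[of "2 * (i - 1) - d" "2 * i - d"] by simp
  qed (simp_all add: q_nonzero)
  show ?thesis
    by (intro exI[of _ K] exI[of _ K'] conjI allI K K' KX KY fun_cong[OF i1] fun_cong[OF i2])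
qed

text \<open>On the decomposition for \<open>K\<close>, \<open>P\<close> minus its scalar lowers
  \<open>G\<close> by one while \<open>P\<close> widens \<open>F\<close> by one. So it maps
  \<open>sp.U i\<close> into \<open>sp.U (i - 1)\<close>, where the scalar of \<open>K\<close> is
  \<open>q^2\<close> times as large.\<close>

lemma P_arrow_K:
  assumes K: "endo K" "endo K'" "\<And>v. K (K' v) = v" "arrow q K X" "arrow q K' Y"
    and P: "endo P" "arrow q X P" "arrow q P Y"
  shows "arrow q P K"
proof (rule sp.arrowI[OF P(1) K(1)], rule arrow_right_at[OF P(1) K(1)])
  fix i v assume v: "v \<in> sp.U i"
  show "K v = q powi (d - 2 * i) *s v" by (rule K_on_U[OF K v])
  let ?w = "P v - inverse (q powi (d - 2 * i)) *s v"
  have w: "?w = P v - q powi (2 * i - d) *s v" using inverse_powi[of "2 * i - d" "d - 2 * i"] by simp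
  have "?w \<in> sp.G (i - 1)" unfolding w
    by (rule sp.G_shift[OF P(1) sp.Es_in_G[OF arrow_Y_VY[OF P(1,3)] order_refl]])
      (use v in \<open>simp_all add: sp.U_def\<close>)
  moreover have "P v \<in> sp.F (i - 1)"
    by (rule sp.F_widen[OF P(1) sp.E_in_F[OF X_arrow_VX[OF P(1,2)] order_refl]])
      (use v in \<open>simp_all add: sp.U_def\<close>)
  then have "?w \<in> sp.F (i - 1)"
    using v sp.F_antimono[of "i - 1" i]
    by (intro subspace_diff subspace_scale sp.subspace_F) (auto simp: sp.U_def)
  ultimately have "?w \<in> sp.U (i - 1)" by (simp add: sp.U_def)
  from K_on_U[OF K this] show "K ?w = (q\<^sup>2 * q powi (d - 2 * i)) *s ?w"
    using powi_cong_times[of "d - 2 * (i - 1)" "d - 2 * i"] by simp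
qed (use q_nonzero in simp_all)

section \<open>The Serre relations\<close>

lemma serre_X_Y: "serre q X Y"
  by (rule serre_if_tridiagonal[OF endo_X endo_Y q_nonzero q_square sp.E_span _ sp.E_tri powi_cubic])
    (simp_all add: eigenspace_def)

text \<open>\<open>P\<close> is scalar on each \<open>sr.U i\<close>, and \<open>Q\<close> widens
  both flags by one step, hence is tridiagonal on this decomposition.\<close>

lemma serre_P_Q:
  assumes P: "endo P" "arrow q X P" "arrow q P Y" and Q: "endo Q" "arrow q Y Q" "arrow q Q X"
  shows "serre q P Q"
proof (rule serre_if_tridiagonal[OF P(1) Q(1) q_nonzero q_square sr.span_U P_on_U[OF P] _ powi_cubic])
  fix i v assume v: "v \<in> sr.U i"
  have "Q v \<in> sr.G (i + 1)"
    by (rule sr.G_widen[OF Q(1) sr.Es_in_G[OF Y_arrow_VY[OF Q(1,2)] order_refl]])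
      (use v in \<open>simp_all add: sr.U_def\<close>)
  moreover have "Q v \<in> sr.F (i - 1)"
  proof (rule sr.F_widen[OF Q(1)])
    fix k v assume "v \<in> eigenspace scale X (q powi (d - 2 * k))"
    then have "v \<in> VX (d - k)" by (simp add: algebra_simps)
    from arrow_X_VX[OF Q(1,3) this]
    have "Q v - q powi (2 * k - d) *s v \<in> eigenspace scale X (q powi (d - 2 * (k - 1)))"
      by (simp add: algebra_simps)
    then show "Q v - q powi (2 * k - d) *s v \<in> sr.F (k - 1)" by (rule sr.E_in_F) simp
  qed (use v in \<open>simp add: sr.U_def\<close>)
  ultimately show "Q v \<in> span (\<Union>k\<in>{i - 1..i + 1}. sr.U k)" by (rule sr.GF_in_span_U)
qed

text \<open>This forces \<open>k\<^sub>0 k\<^sub>1\<close> to act as the identity. With \<open>P\<close> the solution for \<open>D = 1\<close>, the map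
  \<open>Z = R - D P\<close> lowers the flag \<open>G\<close>, hence is nilpotent, while it agrees with a multiple of
  \<open>1 - D\<close> on the eigenspace \<open>VX 0\<close>; so \<open>D\<close> fixes a nonzero vector.\<close>

lemma central_factor_trivial:
  assumes D: "endo D" "\<And>v. D (X v) = X (D v)" "\<And>v. D (Y v) = Y (D v)"
    and R: "endo R" "arrow q X R"
    and RY: "\<And>v. q *s R (Y v) - inverse q *s Y (R v) = (q - inverse q) *s D v"
  shows "D v = v"
proof -
  obtain P where P: "endo P" "arrow q X P" "arrow q P Y" using P_exists by blast
  define Z where "Z = (\<lambda>v. R v - D (P v))"
  have Z: "endo Z" unfolding Z_def by (rule endoI) (simp_all add: D(1) R(1) P(1) endo_simps algebra_simps)
  \<comment> \<open>\<open>R\<close> and \<open>D P\<close> satisfy the same inhomogeneous relation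
    with \<open>Y\<close>, so their difference satisfies the homogeneous one.\<close>
  have ZY: "q *s Z (Y v) = inverse q *s Y (Z v)" for v
  proof -
    have "D (q *s P (Y v) - inverse q *s Y (P v)) = (q - inverse q) *s D v"
      using P(3) by (simp add: arrow_def endo_scale[OF D(1)])
    then have "q *s D (P (Y v)) - inverse q *s Y (D (P v)) = (q - inverse q) *s D v"
      by (simp add: endo_simps[OF D(1)] D(3))
    then have "q *s R (Y v) - inverse q *s Y (R v) = q *s D (P (Y v)) - inverse q *s Y (D (P v))"
      using RY[of v] by simp
    then show ?thesis
      by (simp add: Z_def endo_simps[OF endo_Y] algebra_simps)
  qed
  have ZVY: "Z v \<in> VY (k - 1)" if "v \<in> VY k" for v k
  proof -
    have "(q * q powi (d - 2 * k)) *s Z v = inverse q *s Y (Z v)"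
      using ZY[of v] that by (simp add: eigenspace_def endo_scale[OF Z])
    then have "q *s ((q * q powi (d - 2 * k)) *s Z v) = q *s (inverse q *s Y (Z v))" by simp
    then have "Y (Z v) = (q\<^sup>2 * q powi (d - 2 * k)) *s Z v"
      using q_nonzero by (simp add: power2_eq_square mult.assoc)
    then show ?thesis
      using powi_cong_times[of "d - 2 * (k - 1)" "d - 2 * k"] by (simp add: eigenspace_def)
  qed
  have ZG: "Z v \<in> sp.G (j - 1)" if "v \<in> sp.G j" for v j
    using sp.G_shift[OF Z _ that, of "\<lambda>_. 0"] sp.Es_in_G[OF ZVY order_refl] by simp
  have DX: "D v \<in> VX 0" if "v \<in> VX 0" for v
    using that by (simp add: eigenspace_def D(2)[symmetric] endo_scale[OF D(1)])
  \<comment> \<open>The error term would lie in \<open>VX (- 1)\<close>, which is zero.\<close>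
  have low: "M v = q powi d *s v" if "endo M" "arrow q X M" "v \<in> VX 0" for M v
    using X_arrow_VX[OF that] sp.E_outside[of "-1"] by simp
  have ZX: "Z v = q powi d *s (v - D v)" if "v \<in> VX 0" for v
    using low[OF R that] low[OF P(1,2) that] by (simp add: Z_def endo_scale[OF D(1)] algebra_simps)
  \<comment> \<open>The least such \<open>n\<close> gives the first member of the flag
    \<open>G\<close> that meets \<open>VX 0\<close>. The offset makes \<open>B 0\<close> false, so
    \<open>n\<close> has a predecessor.\<close>
  define B where "B n \<longleftrightarrow> (\<exists>v. v \<noteq> 0 \<and> v \<in> VX 0 \<and> v \<in> sp.G (int n - 1))" for n
  have "\<exists>v. v \<noteq> 0 \<and> v \<in> VX 0" using sp.E_nonzero[of 0] sp.d_nonneg by simp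
  then have "B (nat (d + 1))" using sp.G_eq_UNIV[of d] sp.d_nonneg by (auto simp: B_def)
  then have B: "B (LEAST n. B n)" by (rule LeastI)
  moreover have "\<not> B 0" using sp.G_eq_0[of "-1"] by (auto simp: B_def)
  ultimately obtain n where n: "(LEAST n. B n) = Suc n" by (metis not0_implies_Suc)
  then have "\<not> B n" using not_less_Least[of n B] by simp
  obtain v where v: "v \<noteq> 0" "v \<in> VX 0" "v \<in> sp.G (int n)" using B n by (auto simp: B_def)
  have "Z v \<in> sp.G (int n - 1)" using ZG[OF v(3)] .
  moreover have "Z v \<in> VX 0"
  proof -
    have "v - D v \<in> VX 0"
      using v(2) DX[OF v(2)] by (simp add: eigenspace_def endo_diff[OF endo_X] algebra_simps)
    then show ?thesis
      unfolding ZX[OF v(2)] by (simp add: eigenspace_def endo_scale[OF endo_X] mult.commute)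
  qed
  \<comment> \<open>By minimality, as \<open>Z v\<close> lies in \<open>VX 0\<close> and one step
    lower in the flag.\<close>
  ultimately have "Z v = 0" using \<open>\<not> B n\<close> by (auto simp: B_def)
  then have Dv: "D v = v" using ZX[OF v(2)] q_nonzero by simp
  have "{v. D v = v} = {0} \<or> {v. D v = v} = UNIV"
    by (rule sp.irred) (auto simp: subspace_def endo_simps[OF D(1)] D)
  then show ?thesis using v(1) Dv by blast
qed

end

section \<open>Module structures\<close>

fun other :: "idx \<Rightarrow> idx" where
  "other I0 = I1"
| "other I1 = I0"

fun flip :: "ugen \<Rightarrow> ugen" where
  "flip (Yp i) = Ym (other i)"
| "flip (Ym i) = Yp (other i)"
| "flip (Kg i) = Kg (other i)"
| "flip (Kinv i) = Kinv (other i)"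

lemma all_idx: "(\<forall>i. R i) \<longleftrightarrow> R I0 \<and> R I1"
  by (metis idx.exhaust)

lemma other_other [simp]: "other (other i) = i"
  by (cases i) simp_all

lemma flip_flip [simp]: "flip (flip g) = g"
  by (cases g) simp_all

context endomorphisms
begin

text \<open>Pointwise form of the relations with the denominator \<open>q - inverse q\<close>
  cleared; with only two indices, \<open>i \<noteq> j\<close> means
  \<open>j = other i\<close>.\<close>

lemma is_U_module_iff:
  assumes "q - inverse q \<noteq> 0"
  shows "is_U_module scale q \<rho> \<longleftrightarrow>
    (\<forall>g. endo (\<rho> g)) \<and>
    (\<forall>i v. \<rho> (Kg i) (\<rho> (Kinv i) v) = v \<and> \<rho> (Kinv i) (\<rho> (Kg i) v) = v) \<and>
    (\<forall>g v. \<rho> (Kg I0) (\<rho> (Kg I1) (\<rho> g v)) = \<rho> g (\<rho> (Kg I0) (\<rho> (Kg I1) v))) \<and>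
    (\<forall>i. arrow q (\<rho> (Yp i)) (\<rho> (Kg i)) \<and> arrow q (\<rho> (Kg i)) (\<rho> (Ym i))
       \<and> arrow q (\<rho> (Ym i)) (\<rho> (Yp i))) \<and>
    (\<forall>i v. q *s \<rho> (Yp i) (\<rho> (Ym (other i)) v) - inverse q *s \<rho> (Ym (other i)) (\<rho> (Yp i) v)
       = (q - inverse q) *s \<rho> (Kinv I0) (\<rho> (Kinv I1) v)) \<and>
    (\<forall>i. serre q (\<rho> (Yp i)) (\<rho> (Yp (other i))) \<and> serre q (\<rho> (Ym i)) (\<rho> (Ym (other i))))"
proof -
  have c: "inverse (q - inverse q) *s x = y \<longleftrightarrow> x = (q - inverse q) *s y" for x y
    using assms by (metis left_inverse right_inverse scale_one scale_scale)
  show ?thesis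
    unfolding is_U_module_def Let_def fun_eq_iff o_apply id_apply c arrow_def serre_def
    by (auto simp add: all_idx)
qed

lemma qcomm_inverse:
  "inverse q *s x - q *s y = (inverse q - q) *s w \<longleftrightarrow> q *s y - inverse q *s x = (q - inverse q) *s w"
  by (metis minus_diff_eq scale_minus_left)

text \<open>Exchanging \<open>y\<^sub>i\<^sup>+\<close> with \<open>y\<^sub>1\<^sub>-\<^sub>i\<^sup>-\<close> and \<open>k\<^sub>0\<close> with \<open>k\<^sub>1\<close> turns the relations for
  \<open>q\<^sup>-\<^sup>1\<close> into those for \<open>q\<close>; this carries the first module structure to the second.\<close>

lemma is_U_module_flip:
  assumes "q - inverse q \<noteq> 0" and "is_U_module scale (inverse q) \<rho>"
  shows "is_U_module scale q (\<lambda>g. \<rho> (flip g))"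
proof -
  have "inverse q - inverse (inverse q) \<noteq> 0" using assms(1) by simp
  note M = assms(2)[unfolded is_U_module_iff[OF this] inverse_inverse_eq]
  have serre: "serre (inverse q) x y \<longleftrightarrow> serre q x y" for x y
  proof -
    have "qint3 (inverse q) = qint3 q"
      unfolding qint3_def inverse_inverse_eq by (metis minus_diff_eq minus_divide_divide)
    then show ?thesis by (simp add: serre_def)
  qed
  have K: "\<rho> (Kg i) (\<rho> (Kinv i) v) = v" "\<rho> (Kinv i) (\<rho> (Kg i) v) = v" for i v
    using M by blast+
  have central: "\<rho> (Kg I0) (\<rho> (Kg I1) (\<rho> g v)) = \<rho> g (\<rho> (Kg I0) (\<rho> (Kg I1) v))" for g v
    using M by blast
  \<comment> \<open>\<open>flip\<close> reverses the order in the product of \<open>k_0\<close> and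
    \<open>k_1\<close>, so the two must be seen to commute: apply centrality to \<open>k_0\<close>
    and cancel it.\<close>
  have comm: "\<rho> (Kg I1) (\<rho> (Kg I0) v) = \<rho> (Kg I0) (\<rho> (Kg I1) v)" for v
    by (metis K(2) central)
  have comm': "\<rho> (Kinv I1) (\<rho> (Kinv I0) v) = \<rho> (Kinv I0) (\<rho> (Kinv I1) v)" for v
    by (metis K comm)
  show ?thesis
    using M
    by (simp add: is_U_module_iff[OF assms(1)] all_idx comm comm' central arrow_inverse serre qcomm_inverse)
qed

end

context q_pair
begin

lemma q_diff_nonzero: "q - inverse q \<noteq> 0"
  using q_nonzero q_square by (simp add: field_simps power2_eq_square)

lemma U_module_ex1: "\<exists>!\<rho>. is_U_module scale q \<rho> \<and> \<rho> (Ym I1) = X \<and> \<rho> (Ym I0) = Y"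
proof -
  interpret sw: q_pair scale q Y X d by (rule q_pair_swap)
  obtain P where P: "endo P" "arrow q X P" "arrow q P Y" using P_exists by blast
  obtain Q where Q: "endo Q" "arrow q Y Q" "arrow q Q X" using sw.P_exists by blast
  obtain K K' where K: "endo K" "endo K'" "\<And>v. K (K' v) = v" "arrow q K X" "arrow q K' Y"
    and K'K: "\<And>v. K' (K v) = v" using K_exists by blast
  \<comment> \<open>Since \<open>k_0\<close> is to be the inverse of \<open>k_1\<close>, it acts as
    \<open>K'\<close> and its inverse as \<open>K\<close>.\<close>
  define \<rho>0 where "\<rho>0 g = (case g of
      Yp i \<Rightarrow> (case i of I0 \<Rightarrow> Q | I1 \<Rightarrow> P)
    | Ym i \<Rightarrow> (case i of I0 \<Rightarrow> Y | I1 \<Rightarrow> X)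
    | Kg i \<Rightarrow> (case i of I0 \<Rightarrow> K' | I1 \<Rightarrow> K)
    | Kinv i \<Rightarrow> (case i of I0 \<Rightarrow> K | I1 \<Rightarrow> K'))" for g
  have endo_\<rho>0: "endo (\<rho>0 g)" for g
    using P(1) Q(1) K(1,2) endo_X endo_Y by (auto simp: \<rho>0_def split: ugen.split idx.split)
  have PY: "q *s P (Y v) - inverse q *s Y (P v) = (q - inverse q) *s v"
    and QX: "q *s Q (X v) - inverse q *s X (Q v) = (q - inverse q) *s v" for v
    using P(3) Q(3) by (simp_all add: arrow_def)
  have "is_U_module scale q \<rho>0"
    unfolding is_U_module_iff[OF q_diff_nonzero]
    by (simp add: all_idx endo_\<rho>0) (simp add: \<rho>0_def K K'K P Q PY QX P_arrow_K[OF K P]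
        sw.P_arrow_K[OF K(2,1) K'K K(5,4) Q] serre_P_Q[OF P Q] sw.serre_P_Q[OF Q P] serre_X_Y sw.serre_X_Y)
  moreover have "\<rho> = \<rho>0" if \<rho>: "is_U_module scale q \<rho> \<and> \<rho> (Ym I1) = X \<and> \<rho> (Ym I0) = Y" for \<rho>
  proof -
    note M = conjunct1[OF \<rho>, unfolded is_U_module_iff[OF q_diff_nonzero]]
    have X: "\<rho> (Ym I1) = X" and Y: "\<rho> (Ym I0) = Y" using \<rho> by auto
    have e: "endo (\<rho> g)" for g using M by blast
    have inv: "\<rho> (Kg i) (\<rho> (Kinv i) v) = v" "\<rho> (Kinv i) (\<rho> (Kg i) v) = v" for i v
      using M by blast+
    have central: "\<rho> (Kg I0) (\<rho> (Kg I1) (\<rho> g v)) = \<rho> g (\<rho> (Kg I0) (\<rho> (Kg I1) v))" for g v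
      using M by blast
    have a: "arrow q (\<rho> (Kg i)) (\<rho> (Ym i))" "arrow q (\<rho> (Ym i)) (\<rho> (Yp i))" for i
      using M by blast+
    have mixed: "q *s \<rho> (Yp i) (\<rho> (Ym (other i)) v) - inverse q *s \<rho> (Ym (other i)) (\<rho> (Yp i) v)
       = (q - inverse q) *s \<rho> (Kinv I0) (\<rho> (Kinv I1) v)" for i v
      using M by blast
    have comm: "\<rho> (Kg I1) (\<rho> (Kg I0) v) = \<rho> (Kg I0) (\<rho> (Kg I1) v)" for v
      by (metis inv(2) central)
    \<comment> \<open>The inverse of the central \<open>k_0 k_1\<close> and the right side of the
      mixed relations. Once it is the identity, those relations become the arrows to
      \<open>Y\<close> and \<open>X\<close> that determine \<open>P\<close> and
      \<open>Q\<close>.\<close>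
    define D where "D = (\<lambda>v. \<rho> (Kinv I0) (\<rho> (Kinv I1) v))"
    have DC: "D (\<rho> (Kg I0) (\<rho> (Kg I1) v)) = v" "\<rho> (Kg I0) (\<rho> (Kg I1) (D v)) = v" for v
      by (simp_all add: D_def comm[symmetric] inv)
    have D_central: "D (\<rho> g v) = \<rho> g (D v)" for g v
      by (metis DC central)
    have "endo D" unfolding D_def by (rule endoI) (simp_all add: e endo_simps)
    then have D: "D v = v" for v
      using central_factor_trivial[of D "\<rho> (Yp I1)" v] D_central[of "Ym I1"] D_central[of "Ym I0"]
        e a(2)[of I1] mixed[of I1] by (simp add: X Y D_def)
    have K0: "\<rho> (Kg I0) = \<rho> (Kinv I1)" and K1: "\<rho> (Kinv I0) = \<rho> (Kg I1)"
      using D inv by (metis D_def ext)+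
    have "\<rho> (Yp I1) = P"
      using mixed[of I1] D a(2)[of I1]
      by (intro P_unique[OF e _ _ P]) (simp_all add: X Y D_def arrow_def)
    moreover have "\<rho> (Yp I0) = Q"
      using mixed[of I0] D a(2)[of I0]
      by (intro sw.P_unique[OF e _ _ Q]) (simp_all add: X Y D_def arrow_def)
    moreover have K1K: "\<rho> (Kg I1) = K"
      using a(1)[of I1] a(1)[of I0]
      by (intro K_unique[OF e e inv(1) _ _ K]) (simp_all add: X Y K0)
    moreover have "\<rho> (Kinv I1) = K'"
    proof
      fix v
      have "\<rho> (Kinv I1) v = K' (K (\<rho> (Kinv I1) v))" by (simp add: K'K)
      then show "\<rho> (Kinv I1) v = K' v" by (simp add: K1K[symmetric] inv)
    qed
    ultimately have "\<rho> g = \<rho>0 g" for g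
      by (simp add: \<rho>0_def K0 K1 X Y split: ugen.split idx.split)
    then show ?thesis by blast
  qed
  moreover have "\<rho>0 (Ym I1) = X" "\<rho>0 (Ym I0) = Y" by (simp_all add: \<rho>0_def)
  ultimately show ?thesis by blast
qed

text \<open>\<open>flip\<close> is an involution, so it matches structures of the first kind for
  \<open>inverse q\<close> with those of the second kind for \<open>q\<close>, and uniqueness
  carries over.\<close>

lemma U_module_plus_ex1: "\<exists>!\<rho>. is_U_module scale q \<rho> \<and> \<rho> (Yp I0) = X \<and> \<rho> (Yp I1) = Y"
proof -
  interpret i: q_pair scale "inverse q" X Y d by (rule q_pair_inverse)
  obtain \<rho> where \<rho>: "is_U_module scale (inverse q) \<rho>" "\<rho> (Ym I1) = X" "\<rho> (Ym I0) = Y"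
    and unique: "\<And>\<rho>'. is_U_module scale (inverse q) \<rho>' \<and> \<rho>' (Ym I1) = X \<and> \<rho>' (Ym I0) = Y \<Longrightarrow> \<rho>' = \<rho>"
    using i.U_module_ex1 by blast
  show ?thesis
  proof (rule ex1I[of _ "\<lambda>g. \<rho> (flip g)"])
    show "is_U_module scale q (\<lambda>g. \<rho> (flip g)) \<and> \<rho> (flip (Yp I0)) = X \<and> \<rho> (flip (Yp I1)) = Y"
      using is_U_module_flip[OF q_diff_nonzero \<rho>(1)] \<rho> by simp
    fix \<rho>' assume *: "is_U_module scale q \<rho>' \<and> \<rho>' (Yp I0) = X \<and> \<rho>' (Yp I1) = Y"
    have "(\<lambda>g. \<rho>' (flip g)) = \<rho>"
      using * is_U_module_flip[of "inverse q" \<rho>'] i.q_diff_nonzero by (intro unique) simp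
    then show "\<rho>' = (\<lambda>g. \<rho> (flip g))" by auto
  qed
qed

lemma irreducible_U_moduleI:
  assumes "is_U_module scale q \<rho>" "X = \<rho> g" "Y = \<rho> h"
  shows "irreducible_U_module scale q \<rho>"
  unfolding irreducible_U_module_def
proof (intro conjI allI impI)
  show "\<exists>v::'v. v \<noteq> 0" using sp.E_nonzero[of 0] sp.d_nonneg by auto
  fix W assume "subspace W \<and> (\<forall>g. \<rho> g ` W \<subseteq> W)"
  then show "W = {0} \<or> W = UNIV" using assms by (intro sp.irred) auto
qed (fact assms)

end

section \<open>From a tridiagonal pair to a normalised pair\<close>

lemma powi_eq_iff:
  fixes q :: "'K::field"
  assumes "q \<noteq> 0" "\<forall>m::nat. m > 0 \<longrightarrow> q ^ m \<noteq> 1"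
  shows "q powi m = q powi n \<longleftrightarrow> m = n"
proof -
  have "\<not> m < n" if "q powi m = q powi n" for m n
  proof
    assume "m < n"
    have "q powi (n - m) = 1" using that assms(1) by (simp add: power_int_diff)
    then have "q ^ nat (n - m) = 1" using \<open>m < n\<close> by (simp add: power_int_def)
    then show False using assms(2) \<open>m < n\<close> by auto
  qed
  then show ?thesis by (metis linorder_neqE)
qed

context endomorphisms
begin

lemma eigenspace_scaled:
  assumes "a \<noteq> 0"
  shows "eigenspace scale (\<lambda>v. inverse a *s f v) c = eigenspace scale f (a * c)"
proof -
  have "inverse a *s f v = c *s v \<longleftrightarrow> f v = (a * c) *s v" for v
    using assms by (metis left_inverse right_inverse scale_one scale_scale)
  then show ?thesis by (simp add: eigenspace_def)
qed

text \<open>Outside \<open>0..n\<close> the eigenspace is zero because every eigenvalue is some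
  \<open>a * e (int k)\<close> with \<open>k \<le> n\<close>, and \<open>e\<close> is injective on
  all integers.\<close>

lemma ord_eigenspace_scaled:
  assumes "eigenvalue_ordering scale f n \<theta>" "endo f" "a \<noteq> 0" "inj e" "\<forall>k\<le>n. \<theta> k = a * e (int k)"
  shows "ord_eigenspace scale f n \<theta> i = eigenspace scale (\<lambda>v. inverse a *s f v) (e i)"
proof (cases "0 \<le> i \<and> i \<le> int n")
  case True
  then have "\<theta> (nat i) = a * e i" using assms(5)[rule_format, of "nat i"] by (simp add: nat_le_iff)
  then show ?thesis using True by (simp add: ord_eigenspace_def eigenspace_scaled[OF assms(3)])
next
  case False
  have "\<not> is_eigenvalue scale f (a * e i)"
  proof
    assume "is_eigenvalue scale f (a * e i)"
    then have "a * e i \<in> \<theta> ` {..n}" using assms(1) by (simp add: eigenvalue_ordering_def)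
    then obtain k where "k \<le> n" "a * e i = a * e (int k)" using assms(5) by auto
    then have "i = int k" using assms(3,4) by (simp add: inj_eq)
    then show False using False \<open>k \<le> n\<close> by simp
  qed
  then have "eigenspace scale f (a * e i) = {0}"
    using endo_zero[OF assms(2)] by (auto simp: is_eigenvalue_def eigenspace_def)
  then show ?thesis unfolding eigenspace_scaled[OF assms(3)] using False by (auto simp: ord_eigenspace_def)
qed

text \<open>Supplies the \<open>split_pair\<close> conditions for one of the two maps; the free
  factor \<open>b\<close> allows the other map to be rescaled as well.\<close>

lemma standard_ordering_scaled:
  assumes std: "standard_ordering scale f g n \<theta>" and f: "endo f" and dg: "diagonalizable scale f"
    and a: "a \<noteq> 0" and e: "inj e" "\<forall>k\<le>n. \<theta> k = a * e (int k)"
  defines "E \<equiv> \<lambda>i. eigenspace scale (\<lambda>v. inverse a *s f v) (e i)"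
  shows "\<not> (0 \<le> i \<and> i \<le> int n) \<Longrightarrow> E i = {0}"
    and "0 \<le> i \<Longrightarrow> i \<le> int n \<Longrightarrow> \<exists>v. v \<noteq> 0 \<and> v \<in> E i"
    and "span (\<Union>i. E i) = UNIV"
    and "endo g \<Longrightarrow> v \<in> E i \<Longrightarrow> b *s g v \<in> span (\<Union>k\<in>{i - 1..i + 1}. E k)"
proof -
  have ord: "eigenvalue_ordering scale f n \<theta>" using std by (simp add: standard_ordering_def)
  have E: "E i = ord_eigenspace scale f n \<theta> i" for i
    using ord_eigenspace_scaled[OF ord f a e] by (simp add: E_def)
  show out: "\<not> (0 \<le> i \<and> i \<le> int n) \<Longrightarrow> E i = {0}" for i
    unfolding E by (auto simp: ord_eigenspace_def)
  have eig: "\<theta> ` {..n} = {lam. is_eigenvalue scale f lam}"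
    using ord by (simp add: eigenvalue_ordering_def)
  show "\<exists>v. v \<noteq> 0 \<and> v \<in> E i" if "0 \<le> i" "i \<le> int n"
  proof -
    have "\<theta> (nat i) \<in> \<theta> ` {..n}" using that by auto
    then have "is_eigenvalue scale f (\<theta> (nat i))" using eig by simp
    then show ?thesis using that unfolding E by (auto simp: is_eigenvalue_def ord_eigenspace_def eigenspace_def)
  qed
  have "(\<Union>lam\<in>{lam. is_eigenvalue scale f lam}. eigenspace scale f lam) \<subseteq> (\<Union>i. E i)"
  proof
    fix v assume "v \<in> (\<Union>lam\<in>{lam. is_eigenvalue scale f lam}. eigenspace scale f lam)"
    then obtain k where "k \<le> n" "v \<in> eigenspace scale f (\<theta> k)" unfolding eig[symmetric] by auto
    then have "v \<in> E (int k)" unfolding E by (simp add: ord_eigenspace_def)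
    then show "v \<in> (\<Union>i. E i)" by blast
  qed
  from span_mono[OF this] show "span (\<Union>i. E i) = UNIV"
    using dg by (auto simp: diagonalizable_def)
  show "b *s g v \<in> span (\<Union>k\<in>{i - 1..i + 1}. E k)" if g: "endo g" and v: "v \<in> E i"
  proof (cases "0 \<le> i \<and> i \<le> int n")
    case True
    then have "g ` E i \<subseteq> span (E (i - 1) \<union> E i \<union> E (i + 1))"
      using std unfolding standard_ordering_def E by blast
    then have "g v \<in> span (E (i - 1) \<union> E i \<union> E (i + 1))" using v by blast
    moreover have "E (i - 1) \<union> E i \<union> E (i + 1) \<subseteq> (\<Union>k\<in>{i - 1..i + 1}. E k)" by force
    ultimately show ?thesis using span_mono by (blast intro: span_scale)
  next
    case False
    then show ?thesis using v out[of i] endo_zero[OF g] by (simp add: span_zero)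
  qed
qed

lemma q_pair_of_tridiagonal_pair:
  assumes q: "q \<noteq> 0" "\<forall>m::nat. m > 0 \<longrightarrow> q ^ m \<noteq> 1"
    and td: "tridiagonal_pair scale A As"
    and std: "standard_ordering scale A As d \<theta>" "standard_ordering scale As A d \<theta>s"
    and a: "a \<noteq> 0" "as \<noteq> 0"
    and \<theta>: "\<forall>i\<le>d. \<theta> i = a * q powi (2 * int i - int d)"
      "\<forall>i\<le>d. \<theta>s i = as * q powi (int d - 2 * int i)"
  shows "q_pair scale q (\<lambda>v. inverse a *s A v) (\<lambda>v. inverse as *s As v) (int d)"
proof (intro q_pair.intro q_pair_axioms.intro endomorphisms_axioms split_pair.intro split_pair_axioms.intro)
  have lin: "endo A" "endo As" and dg: "diagonalizable scale A" "diagonalizable scale As"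
    using td by (auto simp: tridiagonal_pair_def)
  show "q \<noteq> 0" by fact
  show "q\<^sup>2 \<noteq> 1" using q(2) by simp
  show "0 \<le> int d" by simp
  show "endo (\<lambda>v. inverse a *s A v)" "endo (\<lambda>v. inverse as *s As v)"
    using lin by (auto intro!: endoI simp: endo_simps algebra_simps)
  show inj: "inj (\<lambda>i. q powi (2 * i - int d))" "inj (\<lambda>i. q powi (int d - 2 * i))"
    by (auto intro!: injI simp: powi_eq_iff[OF q])
  note A = standard_ordering_scaled[OF std(1) lin(1) dg(1) a(1) inj(1) \<theta>(1)]
  note As = standard_ordering_scaled[OF std(2) lin(2) dg(2) a(2) inj(2) \<theta>(2)]
  show "span (\<Union>i. eigenspace scale (\<lambda>v. inverse a *s A v) (q powi (2 * i - int d))) = UNIV"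
    by (rule A(3))
  show "span (\<Union>i. eigenspace scale (\<lambda>v. inverse as *s As v) (q powi (int d - 2 * i))) = UNIV"
    by (rule As(3))
  fix i
  show "\<not> (0 \<le> i \<and> i \<le> int d) \<Longrightarrow> eigenspace scale (\<lambda>v. inverse a *s A v) (q powi (2 * i - int d)) = {0}"
    by (rule A(1))
  show "\<not> (0 \<le> i \<and> i \<le> int d) \<Longrightarrow> eigenspace scale (\<lambda>v. inverse as *s As v) (q powi (int d - 2 * i)) = {0}"
    by (rule As(1))
  show "0 \<le> i \<Longrightarrow> i \<le> int d \<Longrightarrow>
      \<exists>v. v \<noteq> 0 \<and> v \<in> eigenspace scale (\<lambda>v. inverse a *s A v) (q powi (2 * i - int d))"
    by (rule A(2))
  show "0 \<le> i \<Longrightarrow> i \<le> int d \<Longrightarrow>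
      \<exists>v. v \<noteq> 0 \<and> v \<in> eigenspace scale (\<lambda>v. inverse as *s As v) (q powi (int d - 2 * i))"
    by (rule As(2))
  fix v
  show "v \<in> eigenspace scale (\<lambda>v. inverse a *s A v) (q powi (2 * i - int d)) \<Longrightarrow> inverse as *s As v
      \<in> span (\<Union>k\<in>{i - 1..i + 1}. eigenspace scale (\<lambda>v. inverse a *s A v) (q powi (2 * k - int d)))"
    by (rule A(4)[OF lin(2)])
  show "v \<in> eigenspace scale (\<lambda>v. inverse as *s As v) (q powi (int d - 2 * i)) \<Longrightarrow> inverse a *s A v
      \<in> span (\<Union>k\<in>{i - 1..i + 1}. eigenspace scale (\<lambda>v. inverse as *s As v) (q powi (int d - 2 * k)))"
    by (rule As(4)[OF lin(1)])
next
  fix W assume W: "subspace W" "\<And>v. v \<in> W \<Longrightarrow> inverse a *s A v \<in> W" "\<And>v. v \<in> W \<Longrightarrow> inverse as *s As v \<in> W"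
  have "A v \<in> W" "As v \<in> W" if "v \<in> W" for v
    using subspace_scale[OF W(1) W(2)[OF that], of a] subspace_scale[OF W(1) W(3)[OF that], of as] a
    by simp_all
  moreover have "\<And>W. subspace W \<Longrightarrow> A ` W \<subseteq> W \<Longrightarrow> As ` W \<subseteq> W \<Longrightarrow> W = {0} \<or> W = UNIV"
    using td by (auto simp: tridiagonal_pair_def)
  ultimately show "W = {0} \<or> W = UNIV" using W(1) by blast
qed

end

theorem theorem3p3:
  fixes sc :: "'K::field \<Rightarrow> 'v::ab_group_add \<Rightarrow> 'v"
    and B :: "'v set"
    and q a as :: 'K
    and A As :: "'v \<Rightarrow> 'v"
    and d :: nat
    and \<theta> \<theta>s :: "nat \<Rightarrow> 'K"
  assumes "alg_closed TYPE('K)"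
    and "q \<noteq> 0" and "\<forall>m::nat. m > 0 \<longrightarrow> q ^ m \<noteq> 1"
    and "finite_dimensional_vector_space sc B"
    and "\<exists>v::'v. v \<noteq> 0"
    and "tridiagonal_pair sc A As"
    and "standard_ordering sc A As d \<theta>"
    and "standard_ordering sc As A d \<theta>s"
    and "a \<noteq> 0" and "as \<noteq> 0"
    and "\<forall>i\<le>d. \<theta> i = a * q powi (2 * int i - int d)"
    and "\<forall>i\<le>d. \<theta>s i = as * q powi (int d - 2 * int i)"
  shows "(\<exists>!\<rho>. is_U_module sc q \<rho> \<and> (\<lambda>v. sc a (\<rho> (Ym I1) v)) = A
                                   \<and> (\<lambda>v. sc as (\<rho> (Ym I0) v)) = As)
       \<and> (\<exists>!\<rho>. is_U_module sc q \<rho> \<and> (\<lambda>v. sc a (\<rho> (Yp I0) v)) = A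
                                   \<and> (\<lambda>v. sc as (\<rho> (Yp I1) v)) = As)
       \<and> (\<forall>\<rho>. is_U_module sc q \<rho> \<and> (\<lambda>v. sc a (\<rho> (Ym I1) v)) = A
                \<and> (\<lambda>v. sc as (\<rho> (Ym I0) v)) = As \<longrightarrow> irreducible_U_module sc q \<rho>)
       \<and> (\<forall>\<rho>. is_U_module sc q \<rho> \<and> (\<lambda>v. sc a (\<rho> (Yp I0) v)) = A
                \<and> (\<lambda>v. sc as (\<rho> (Yp I1) v)) = As \<longrightarrow> irreducible_U_module sc q \<rho>)"
proof -
  interpret finite_dimensional_vector_space sc B by fact
  interpret endomorphisms sc by (rule endomorphisms.intro) (rule vector_space_axioms)
  interpret q_pair sc q "\<lambda>v. sc (inverse a) (A v)" "\<lambda>v. sc (inverse as) (As v)" "int d"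
    by (rule q_pair_of_tridiagonal_pair) (use assms in auto)
  \<comment> \<open>Moves \<open>a\<close> and \<open>as\<close> to the other side, so that the
    claims concern the normalised maps.\<close>
  have scaled: "(\<lambda>v. sc c (f v)) = g \<longleftrightarrow> f = (\<lambda>v. sc (inverse c) (g v))" if "c \<noteq> 0" for c f g
  proof
    assume "(\<lambda>v. sc c (f v)) = g"
    then show "f = (\<lambda>v. sc (inverse c) (g v))" using that by auto
  qed (use that in auto)
  show ?thesis
    unfolding scaled[OF \<open>a \<noteq> 0\<close>] scaled[OF \<open>as \<noteq> 0\<close>]
    by (intro conjI U_module_ex1 U_module_plus_ex1)
      (metis irreducible_U_moduleI)+
qed

end
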